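(* Let $X$ be an ru-complete complex vector lattice and let $(T(t))_{t\ge0}$ be a positive exponentially order bounded relatively uniformly continuous semigroup on $X$ with order exponent $w\in\mathbb{R}$ and generator $A$. Write $\mathbb{C}_{>w}=\{\lambda\in\mathbb{C}:\operatorname{Re}\lambda>w\}$. Then the following assertions hold. (i) For each $\lambda\in\mathbb{C}_{>w}$ the mapping $$x\mapsto R(\lambda)x:=\int_0^\infty e^{-\lambda t}T(t)x\,\mathrm{d}t$$ defines a positive linear operator on $X$. (ii) For each $x\in X$ there exists $u\in X$ such that $|R(\lambda)^kx|\le(\operatorname{Re}\lambda-w)^{-k}\,u$ holds for all $k\in\mathbb{N}$ and $\lambda\in\mathbb{C}_{>w}$. (iii) The positive resolvent set $\rho_+(A)$ contains $\mathbb{C}_{>w}$, and $R(\lambda)=R(\lambda,A)$ holds for each $\lambda\in\mathbb{C}_{>w}$.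
   Context: Complex vector lattices. A complex vector lattice $X=X_{\mathbb R}+iX_{\mathbb R}$ is the complexification of a (real, Archimedean) ru-complete vector lattice $X_{\mathbb R}$, with modulus $|x+iy|=\sup_{0\le\theta<2\pi}|\cos(\theta)x+\sin(\theta)y|\in X_{\mathbb R}$. Inequalities are understood in $X_{\mathbb R}$; elements used as upper bounds or regulators lie in the positive cone of $X_{\mathbb R}$. A linear operator on $X$ is positive if it maps the positive cone into itself. Relative uniform convergence. A net $(x_\alpha)$ in $X$ converges relatively uniformly to $x$ (written $\textup{ru-}\lim_\alpha x_\alpha=x$) if there is a regulator $u$ such that for each $\varepsilon>0$ there is $\alpha_0$ with $|x_\alpha-x|\le\varepsilon u$ for all $\alpha\ge\alpha_0$. A sequence is ru-Cauchy if there is a $u$ such that for each $\varepsilon>0$ there is $N$ with $|x_n-x_m|\le\varepsilon u$ for all $n,m\ge N$; the lattice is ru-complete if every ru-Cauchy sequence converges relatively uniformly. Integrals. A function $f:\mathbb{R}_+\to X$ is ru-integrable on $[0,s]$ if there are $I_s\in X$ and a regulator $u_s$ such that for each $\varepsilon>0$ there is $\delta>0$ with $|\sum_{i=1}^n(s_i-s_{i-1})f(t_i)-I_s|\le\varepsilon u_s$ for every partition $\{s_0,\dots,s_n\}$ of $[0,s]$ with $\max_i|s_i-s_{i-1}|\le\delta$ and all $t_i\in[s_{i-1},s_i]$; then $\int_0^sf(t)\,\mathrm{d}t:=I_s$. The improper integral is $\int_0^\infty f(t)\,\mathrm{d}t:=\textup{ru-}\lim_{s\to\infty}\int_0^sf(t)\,\mathrm{d}t$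 when this ru-limit exists. Semigroups. A function $f:\mathbb{R}_+\to X$ is ru-continuous if there is $u:\mathbb{R}_+\to X$ such that for each $\varepsilon>0$ there is $\delta>0$ with $|f(t+h)-f(t)|\le\varepsilon u(t)$ for all $t\ge0$ and $h\in[-\min\{\delta,t\},\delta]$. A relatively uniformly continuous semigroup is a family $(T(t))_{t\ge0}$ of linear operators on $X$ with $T(0)=I_X$, $T(t+s)=T(t)T(s)$ for all $s,t\ge0$, and all orbit maps $t\mapsto T(t)x$ ru-continuous; it is positive if every $T(t)$ is positive. Its generator is $Ax:=\textup{ru-}\lim_{h\searrow0}\frac1h(T(h)x-x)$ with domain $D(A)$ the set of all $x\in X$ for which this ru-limit exists in $X$. A semigroup is exponentially order bounded with order exponent $w\in\mathbb{R}$ if for each $x\in X$ there is $u\in X$ with $|T(t)x|\le e^{wt}u$ for all $t\ge0$. Positive resolvent set. For an operator $A$ on $X$, $\rho_+(A)=\{\lambda\in\mathbb{C}: R(\lambda,A):=(\lambda-A)^{-1}\text{ exists and is a positive operator on }X\}$.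
   Formalization: Positivity of R(λ) in (i) and membership of λ in ρ₊(A) in (iii) are claimed only for real λ > w, since they fail for non-real λ (X = ℂ, T(t) = id, w = 0, λ = 1+i); linearity, the bounds, existence of (λ−A)^{-1} and R(λ) = R(λ,A) hold for all λ in ℂ_{>w}. *)

theory Defs
  imports "HOL-Analysis.Analysis" "HOL-Library.Lattice_Algebras"
begin

section \<open>Archimedean relatively uniformly complete vector lattices\<close>

class vector_lattice = ordered_real_vector + lattice_ab_group_add_abs

class archimedean_vector_lattice = vector_lattice +
  assumes archimedean: "0 \<le> x \<Longrightarrow> (\<And>n::nat. real n *\<^sub>R x \<le> y) \<Longrightarrow> x = 0"

class ru_complete_vector_lattice = archimedean_vector_lattice +
  assumes ru_complete:
    "\<exists>u\<ge>0. \<forall>\<epsilon>>0. \<exists>N. \<forall>n\<ge>N. \<forall>m\<ge>N. \<bar>X n - X m\<bar> \<le> \<epsilon> *\<^sub>R u \<Longrightarrow>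
     \<exists>l. \<exists>u\<ge>0. \<forall>\<epsilon>>0. \<exists>N::nat. \<forall>n\<ge>N. \<bar>X n - l\<bar> \<le> \<epsilon> *\<^sub>R u"


section \<open>Complexification\<close>

datatype 'a complexification = Cplx (re: 'a) (im: 'a)

instantiation complexification :: (ab_group_add) ab_group_add
begin

definition "0 = Cplx 0 0"
definition "z + z' = Cplx (re z + re z') (im z + im z')"
definition "- z = Cplx (- re z) (- im z)"
definition "z - z' = Cplx (re z - re z') (im z - im z')"

instance
  by standard
    (auto simp: zero_complexification_def plus_complexification_def
      uminus_complexification_def minus_complexification_def add.assoc add.commute)

end

definition scaleC :: "complex \<Rightarrow> 'a::real_vector complexification \<Rightarrow> 'a complexification"
    (infixr \<open>*\<^sub>C\<close> 75) where
  "c *\<^sub>C z = Cplx (Re c *\<^sub>R re z - Im c *\<^sub>R im z) (Re c *\<^sub>R im z + Im c *\<^sub>R re z)"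

lemma re_im_simps [simp]:
  "re 0 = 0" "im 0 = 0"
  "re (z + z') = re z + re z'" "im (z + z') = im z + im z'"
  "re (- z) = - re z" "im (- z) = - im z"
  "re (z - z') = re z - re z'" "im (z - z') = im z - im z'"
  by (simp_all add: zero_complexification_def plus_complexification_def
      uminus_complexification_def minus_complexification_def)

lemma re_im_scaleC [simp]:
  "re (c *\<^sub>C z) = Re c *\<^sub>R re z - Im c *\<^sub>R im z"
  "im (c *\<^sub>C z) = Re c *\<^sub>R im z + Im c *\<^sub>R re z"
  by (simp_all add: scaleC_def)

interpretation complexification: vector_space scaleC
  by unfold_locales
    (auto intro!: complexification.expand simp: algebra_simps)

definition modulus :: "'a::ru_complete_vector_lattice complexification \<Rightarrow> 'a" where
  "modulus z = (LEAST m. \<forall>\<theta>\<in>{0..<2 * pi}. \<bar>cos \<theta> *\<^sub>R re z + sin \<theta> *\<^sub>R im z\<bar> \<le> m)"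

text \<open>The positive cone of the real part, viewed inside the complexification. Upper bounds and
  regulators are taken directly as nonnegative elements of type \<open>'a\<close>.\<close>

definition positive_cone :: "'a::ru_complete_vector_lattice complexification set" where
  "positive_cone = {Cplx x 0 |x. 0 \<le> x}"

definition positive_operator ::
    "('a::ru_complete_vector_lattice complexification \<Rightarrow> 'a complexification) \<Rightarrow> bool" where
  "positive_operator T \<longleftrightarrow>
     Vector_Spaces.linear scaleC scaleC T \<and> T ` positive_cone \<subseteq> positive_cone"


subsection \<open>Existence of the modulus\<close>

text \<open>The supremum defining the modulus exists because the underlying lattice is Archimedean and
  ru-complete: the maxima over finer and finer grids of angles form an ru-Cauchy sequence.\<close>

lemma archimedean_le:
  fixes x y u :: "'a::archimedean_vector_lattice"
  assumes "0 \<le> u" and le: "\<And>\<epsilon>::real. \<epsilon> > 0 \<Longrightarrow> x \<le> y + \<epsilon> *\<^sub>R u"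
  shows "x \<le> y"
proof -
  define p where "p = sup (x - y) 0"
  have p0: "0 \<le> p" by (simp add: p_def)
  have pe: "p \<le> \<epsilon> *\<^sub>R u" if "\<epsilon> > 0" for \<epsilon> :: real
    using le[OF that] that \<open>0 \<le> u\<close>
    by (auto simp: p_def algebra_simps intro!: scaleR_nonneg_nonneg)
  have "real n *\<^sub>R p \<le> u" for n :: nat
  proof (cases "n = 0")
    case False
    then have "real n *\<^sub>R p \<le> real n *\<^sub>R ((1 / real n) *\<^sub>R u)"
      by (intro scaleR_left_mono pe) auto
    with False show ?thesis by simp
  qed (use \<open>0 \<le> u\<close> in auto)
  then have "p = 0" using p0 archimedean by blast
  then have "x - y \<le> 0" unfolding p_def by (metis sup.cobounded1)
  then show ?thesis by simp
qed

lemma abs_scaleR_le: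
  fixes x :: "'a::vector_lattice"
  assumes "\<bar>c\<bar> \<le> d"
  shows "\<bar>c *\<^sub>R x\<bar> \<le> d *\<^sub>R \<bar>x\<bar>"
proof -
  have 1: "\<bar>c *\<^sub>R x\<bar> \<le> \<bar>c\<bar> *\<^sub>R \<bar>x\<bar>"
  proof (rule abs_leI)
    show "c *\<^sub>R x \<le> \<bar>c\<bar> *\<^sub>R \<bar>x\<bar>"
    proof (cases "c \<ge> 0")
      case True
      then have "c *\<^sub>R x \<le> c *\<^sub>R \<bar>x\<bar>"
        by (intro scaleR_left_mono abs_ge_self) auto
      with True show ?thesis by simp
    next
      case False
      then have "(- c) *\<^sub>R (- x) \<le> (- c) *\<^sub>R \<bar>x\<bar>"
        by (intro scaleR_left_mono abs_ge_minus_self) auto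
      with False show ?thesis by simp
    qed
    show "- (c *\<^sub>R x) \<le> \<bar>c\<bar> *\<^sub>R \<bar>x\<bar>"
    proof (cases "c \<ge> 0")
      case True
      then have "c *\<^sub>R (- x) \<le> c *\<^sub>R \<bar>x\<bar>"
        by (intro scaleR_left_mono abs_ge_minus_self) auto
      with True show ?thesis by simp
    next
      case False
      then have "(- c) *\<^sub>R x \<le> (- c) *\<^sub>R \<bar>x\<bar>"
        by (intro scaleR_left_mono abs_ge_self) auto
      with False show ?thesis by simp
    qed
  qed
  also have "\<dots> \<le> d *\<^sub>R \<bar>x\<bar>" using assms by (intro scaleR_right_mono) auto
  finally show ?thesis .
qed

lemma cos_sin_lipschitz:
  "\<bar>cos a - cos b\<bar> \<le> \<bar>a - b\<bar>" "\<bar>sin a - sin b\<bar> \<le> \<bar>a - (b::real)\<bar>"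
proof -
  have "norm (cos a - cos b) \<le> 1 * norm (a - b)"
    by (rule field_differentiable_bound[where S = UNIV and f' = "\<lambda>x. - sin x"])
      (auto intro!: derivative_eq_intros)
  then show "\<bar>cos a - cos b\<bar> \<le> \<bar>a - b\<bar>" by simp
  have "norm (sin a - sin b) \<le> 1 * norm (a - b)"
    by (rule field_differentiable_bound[where S = UNIV and f' = "\<lambda>x. cos x"])
      (auto intro!: derivative_eq_intros)
  then show "\<bar>sin a - sin b\<bar> \<le> \<bar>a - b\<bar>" by simp
qed

lemma modulus_sup_exists:
  fixes x y :: "'a::ru_complete_vector_lattice"
  shows "\<exists>l. \<forall>m. (l \<le> m \<longleftrightarrow> (\<forall>\<theta>\<in>{0..<2 * pi}. \<bar>cos \<theta> *\<^sub>R x + sin \<theta> *\<^sub>R y\<bar> \<le> m))"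
proof -
  define g where "g \<theta> = \<bar>cos \<theta> *\<^sub>R x + sin \<theta> *\<^sub>R y\<bar>" for \<theta> :: real
  define u where "u = \<bar>x\<bar> + \<bar>y\<bar>"
  define v where "v = (2 * pi) *\<^sub>R u"
  have u0: "0 \<le> u" by (simp add: u_def)
  then have v0: "0 \<le> v" by (simp add: v_def scaleR_nonneg_nonneg)
  have lip: "g a \<le> g b + \<bar>a - b\<bar> *\<^sub>R u" for a b
  proof -
    have "g a = \<bar>(cos b *\<^sub>R x + sin b *\<^sub>R y) + ((cos a - cos b) *\<^sub>R x + (sin a - sin b) *\<^sub>R y)\<bar>"
      by (simp add: g_def algebra_simps)
    also have "\<dots> \<le> g b + (\<bar>(cos a - cos b) *\<^sub>R x\<bar> + \<bar>(sin a - sin b) *\<^sub>R y\<bar>)"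
      unfolding g_def by (meson abs_triangle_ineq add_left_mono order_trans)
    also have "\<dots> \<le> g b + (\<bar>a - b\<bar> *\<^sub>R \<bar>x\<bar> + \<bar>a - b\<bar> *\<^sub>R \<bar>y\<bar>)"
      by (intro add_mono order_refl abs_scaleR_le cos_sin_lipschitz)
    finally show ?thesis by (simp add: u_def scaleR_add_right)
  qed
  define t where "t n k = 2 * pi * real k / real (Suc n)" for n k :: nat
  define z where "z n = Sup_fin (g ` t n ` {..n})" for n
  have near: "\<exists>k\<le>n. \<bar>\<theta> - t n k\<bar> \<le> 2 * pi / real (Suc n)" if "\<theta> \<in> {0..<2 * pi}" for \<theta> n
  proof -
    define r where "r = \<theta> * real (Suc n) / (2 * pi)"
    define k where "k = nat \<lfloor>r\<rfloor>"
    have r0: "0 \<le> r" using that by (auto simp: r_def)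
    have "\<theta> * real (Suc n) < 2 * pi * real (Suc n)"
      using that by (intro mult_strict_right_mono) auto
    then have r1: "r < real (Suc n)" by (simp add: r_def field_simps)
    have k: "real k \<le> r" "r < real k + 1" using r0 unfolding k_def by linarith+
    have "k \<le> n" using k r1 by linarith
    moreover have "\<theta> - t n k = (r - real k) * (2 * pi / real (Suc n))"
    proof -
      have "N > 0 \<Longrightarrow> \<theta> - 2 * pi * real k / N = (\<theta> * N / (2 * pi) - real k) * (2 * pi / N)"
        for N :: real
        by (simp add: field_simps)
      then show ?thesis unfolding r_def t_def by simp
    qed
    then have "\<bar>\<theta> - t n k\<bar> = \<bar>r - real k\<bar> * (2 * pi / real (Suc n))"
      by (simp add: abs_mult)
    moreover have "\<dots> \<le> 1 * (2 * pi / real (Suc n))"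
      using k by (intro mult_right_mono) auto
    ultimately show ?thesis by auto
  qed
  have tin: "t n k \<in> {0..<2 * pi}" if "k \<le> n" for n k
  proof -
    have "real k / real (Suc n) < 1" using that by simp
    then have "2 * pi * (real k / real (Suc n)) < 2 * pi * 1"
      by (intro mult_strict_left_mono) auto
    then show ?thesis by (simp add: t_def)
  qed
  have gz: "g \<theta> \<le> z n + (1 / real (Suc n)) *\<^sub>R v" if th: "\<theta> \<in> {0..<2 * pi}" for \<theta> n
  proof -
    obtain k where k: "k \<le> n" "\<bar>\<theta> - t n k\<bar> \<le> 2 * pi / real (Suc n)" using near[OF th] by blast
    have "g \<theta> \<le> g (t n k) + \<bar>\<theta> - t n k\<bar> *\<^sub>R u" by (rule lip)
    also have "\<dots> \<le> z n + (2 * pi / real (Suc n)) *\<^sub>R u"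
      using k u0 unfolding z_def
      by (intro add_mono Sup_fin.coboundedI scaleR_right_mono) auto
    finally show ?thesis by (simp add: v_def field_simps)
  qed
  have zle: "z n \<le> m" if "\<And>\<theta>. \<theta> \<in> {0..<2 * pi} \<Longrightarrow> g \<theta> \<le> m" for n m
    unfolding z_def using that tin by (intro Sup_fin.boundedI) auto
  have zz: "z n \<le> z m + (1 / real (Suc m)) *\<^sub>R v" for n m
    by (rule zle) (rule gz)
  have inv: "\<exists>N. \<forall>n\<ge>N. 1 / real (Suc n) \<le> \<epsilon>" if "\<epsilon> > 0" for \<epsilon> :: real
  proof -
    obtain N where N: "1 / real (Suc N) < \<epsilon>" by (rule nat_approx_posE[OF \<open>\<epsilon> > 0\<close>])
    have "1 / real (Suc n) \<le> \<epsilon>" if "N \<le> n" for n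
    proof -
      have "1 / real (Suc n) \<le> 1 / real (Suc N)" using that by (intro divide_left_mono) auto
      with N show ?thesis by linarith
    qed
    then show ?thesis by blast
  qed
  have "\<exists>l. \<exists>u\<ge>0. \<forall>\<epsilon>>0. \<exists>N. \<forall>n\<ge>N. \<bar>z n - l\<bar> \<le> \<epsilon> *\<^sub>R u"
  proof (rule ru_complete, intro exI[of _ v] conjI v0 allI impI)
    fix \<epsilon> :: real assume "\<epsilon> > 0"
    then obtain N where N: "\<And>n. n \<ge> N \<Longrightarrow> 1 / real (Suc n) \<le> \<epsilon>" using inv by blast
    have *: "z n - z m \<le> \<epsilon> *\<^sub>R v" if "m \<ge> N" for n m
    proof -
      have "z n \<le> z m + (1 / real (Suc m)) *\<^sub>R v" by (rule zz)
      also have "\<dots> \<le> z m + \<epsilon> *\<^sub>R v"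
        using N[OF that] v0 by (intro add_left_mono scaleR_right_mono)
      finally show ?thesis by (simp add: algebra_simps)
    qed
    show "\<exists>N. \<forall>n\<ge>N. \<forall>m\<ge>N. \<bar>z n - z m\<bar> \<le> \<epsilon> *\<^sub>R v"
      by (intro exI[of _ N] allI impI abs_leI) (simp_all add: *)
  qed
  then obtain l u' where u': "0 \<le> u'"
    and l: "\<And>\<epsilon>. \<epsilon> > 0 \<Longrightarrow> \<exists>N. \<forall>n\<ge>N. \<bar>z n - l\<bar> \<le> \<epsilon> *\<^sub>R u'" by blast
  have gl: "g \<theta> \<le> l" if th: "\<theta> \<in> {0..<2 * pi}" for \<theta>
  proof (rule archimedean_le[of "u' + v"])
    show "0 \<le> u' + v" using u' v0 by simp
    fix \<epsilon> :: real assume e: "\<epsilon> > 0"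
    obtain N where N: "\<And>n. n \<ge> N \<Longrightarrow> \<bar>z n - l\<bar> \<le> \<epsilon> *\<^sub>R u'" using l[OF e] by blast
    obtain M where M: "\<And>n. n \<ge> M \<Longrightarrow> 1 / real (Suc n) \<le> \<epsilon>" using inv[OF e] by blast
    define n where "n = max M N"
    have "z n - l \<le> \<epsilon> *\<^sub>R u'" 
      using order_trans[OF abs_ge_self N[of n]] by (simp add: n_def)
    then have "z n \<le> l + \<epsilon> *\<^sub>R u'" by (simp add: algebra_simps)
    moreover have "(1 / real (Suc n)) *\<^sub>R v \<le> \<epsilon> *\<^sub>R v"
      using M[of n] v0 by (intro scaleR_right_mono) (auto simp: n_def)
    ultimately have "z n + (1 / real (Suc n)) *\<^sub>R v \<le> (l + \<epsilon> *\<^sub>R u') + \<epsilon> *\<^sub>R v"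
      by (rule add_mono)
    then show "g \<theta> \<le> l + \<epsilon> *\<^sub>R (u' + v)"
      using gz[OF th, of n] by (simp add: scaleR_add_right add.assoc)
  qed
  have lm: "l \<le> m" if ub: "\<And>\<theta>. \<theta> \<in> {0..<2 * pi} \<Longrightarrow> g \<theta> \<le> m" for m
  proof (rule archimedean_le[OF u'])
    fix \<epsilon> :: real assume e: "\<epsilon> > 0"
    obtain N where N: "\<And>n. n \<ge> N \<Longrightarrow> \<bar>z n - l\<bar> \<le> \<epsilon> *\<^sub>R u'" using l[OF e] by blast
    have "l - z N \<le> \<epsilon> *\<^sub>R u'"
      using N[of N] abs_ge_minus_self[of "z N - l"] by simp
    then have "l \<le> z N + \<epsilon> *\<^sub>R u'" by (simp add: algebra_simps)
    also have "\<dots> \<le> m + \<epsilon> *\<^sub>R u'" using zle[OF ub] by simp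
    finally show "l \<le> m + \<epsilon> *\<^sub>R u'" .
  qed
  have "l \<le> m \<longleftrightarrow> (\<forall>\<theta>\<in>{0..<2 * pi}. g \<theta> \<le> m)" for m
    using order_trans[OF gl] lm by blast
  then show ?thesis unfolding g_def by blast
qed

lemma modulus_le_iff:
  "modulus z \<le> m \<longleftrightarrow> (\<forall>\<theta>\<in>{0..<2 * pi}. \<bar>cos \<theta> *\<^sub>R re z + sin \<theta> *\<^sub>R im z\<bar> \<le> m)"
proof -
  obtain l where l: "\<And>m. l \<le> m \<longleftrightarrow>
      (\<forall>\<theta>\<in>{0..<2 * pi}. \<bar>cos \<theta> *\<^sub>R re z + sin \<theta> *\<^sub>R im z\<bar> \<le> m)"
    using modulus_sup_exists[of "re z" "im z"] by blast
  have "modulus z = l"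
    unfolding modulus_def l[symmetric] by (rule Least_equality) auto
  then show ?thesis using l by simp
qed


section \<open>Relative uniform convergence and integrals\<close>

definition ru_tendsto ::
    "('b \<Rightarrow> 'a::ru_complete_vector_lattice complexification) \<Rightarrow> 'a complexification \<Rightarrow> 'b filter \<Rightarrow> bool"
  where
  "ru_tendsto f l F \<longleftrightarrow>
     (\<exists>u\<ge>0. \<forall>\<epsilon>>0. \<forall>\<^sub>F a in F. modulus (f a - l) \<le> \<epsilon> *\<^sub>R u)"

definition ru_Lim ::
    "'b filter \<Rightarrow> ('b \<Rightarrow> 'a::ru_complete_vector_lattice complexification) \<Rightarrow> 'a complexification"
  where
  "ru_Lim F f = (THE l. ru_tendsto f l F)"

lemma complexification_ru_complete:
  fixes Z :: "nat \<Rightarrow> 'a::ru_complete_vector_lattice complexification"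
  assumes "\<exists>u\<ge>0. \<forall>\<epsilon>>0. \<exists>N. \<forall>n\<ge>N. \<forall>m\<ge>N. modulus (Z n - Z m) \<le> \<epsilon> *\<^sub>R u"
  shows "\<exists>z. ru_tendsto Z z sequentially"
proof -
  obtain u where u: "u \<ge> 0"
    and Z: "\<And>\<epsilon>. \<epsilon> > 0 \<Longrightarrow> \<exists>N. \<forall>n\<ge>N. \<forall>m\<ge>N. modulus (Z n - Z m) \<le> \<epsilon> *\<^sub>R u"
    using assms by blast
  have R: "\<bar>re z\<bar> \<le> m" and I: "\<bar>im z\<bar> \<le> m" if "modulus z \<le> m"
    for z :: "'a complexification" and m
    using that[unfolded modulus_le_iff, rule_format, of 0]
      that[unfolded modulus_le_iff, rule_format, of "pi / 2"] by auto
  have U: "modulus z \<le> \<bar>re z\<bar> + \<bar>im z\<bar>" for z :: "'a complexification"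
    unfolding modulus_le_iff
  proof
    fix \<theta> :: real
    have "\<bar>cos \<theta> *\<^sub>R re z + sin \<theta> *\<^sub>R im z\<bar> \<le> \<bar>cos \<theta> *\<^sub>R re z\<bar> + \<bar>sin \<theta> *\<^sub>R im z\<bar>"
      by (rule abs_triangle_ineq)
    also have "\<dots> \<le> 1 *\<^sub>R \<bar>re z\<bar> + 1 *\<^sub>R \<bar>im z\<bar>"
      by (intro add_mono abs_scaleR_le) auto
    finally show "\<bar>cos \<theta> *\<^sub>R re z + sin \<theta> *\<^sub>R im z\<bar> \<le> \<bar>re z\<bar> + \<bar>im z\<bar>" by simp
  qed
  have "\<exists>l. \<exists>u\<ge>0. \<forall>\<epsilon>>0. \<exists>N. \<forall>n\<ge>N. \<bar>re (Z n) - l\<bar> \<le> \<epsilon> *\<^sub>R u"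
  proof (rule ru_complete, intro exI[of _ u] conjI u allI impI)
    fix \<epsilon> :: real assume "\<epsilon> > 0"
    then obtain N where N: "\<forall>n\<ge>N. \<forall>m\<ge>N. modulus (Z n - Z m) \<le> \<epsilon> *\<^sub>R u" using Z by blast
    then have "\<forall>n\<ge>N. \<forall>m\<ge>N. \<bar>re (Z n - Z m)\<bar> \<le> \<epsilon> *\<^sub>R u" using R by blast
    then show "\<exists>N. \<forall>n\<ge>N. \<forall>m\<ge>N. \<bar>re (Z n) - re (Z m)\<bar> \<le> \<epsilon> *\<^sub>R u" by auto
  qed
  then obtain a v where v: "v \<ge> 0"
    and a: "\<And>\<epsilon>. \<epsilon> > 0 \<Longrightarrow> \<exists>N. \<forall>n\<ge>N. \<bar>re (Z n) - a\<bar> \<le> \<epsilon> *\<^sub>R v" by blast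
  have "\<exists>l. \<exists>u\<ge>0. \<forall>\<epsilon>>0. \<exists>N. \<forall>n\<ge>N. \<bar>im (Z n) - l\<bar> \<le> \<epsilon> *\<^sub>R u"
  proof (rule ru_complete, intro exI[of _ u] conjI u allI impI)
    fix \<epsilon> :: real assume "\<epsilon> > 0"
    then obtain N where N: "\<forall>n\<ge>N. \<forall>m\<ge>N. modulus (Z n - Z m) \<le> \<epsilon> *\<^sub>R u" using Z by blast
    then have "\<forall>n\<ge>N. \<forall>m\<ge>N. \<bar>im (Z n - Z m)\<bar> \<le> \<epsilon> *\<^sub>R u" using I by blast
    then show "\<exists>N. \<forall>n\<ge>N. \<forall>m\<ge>N. \<bar>im (Z n) - im (Z m)\<bar> \<le> \<epsilon> *\<^sub>R u" by auto
  qed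
  then obtain b w where w: "w \<ge> 0"
    and b: "\<And>\<epsilon>. \<epsilon> > 0 \<Longrightarrow> \<exists>N. \<forall>n\<ge>N. \<bar>im (Z n) - b\<bar> \<le> \<epsilon> *\<^sub>R w" by blast
  have "ru_tendsto Z (Cplx a b) sequentially"
    unfolding ru_tendsto_def eventually_sequentially
  proof (intro exI[of _ "v + w"] conjI allI impI)
    show "0 \<le> v + w" using v w by simp
    fix \<epsilon> :: real assume e: "\<epsilon> > 0"
    obtain N where N: "\<And>n. n \<ge> N \<Longrightarrow> \<bar>re (Z n) - a\<bar> \<le> \<epsilon> *\<^sub>R v" using a[OF e] by blast
    obtain M where M: "\<And>n. n \<ge> M \<Longrightarrow> \<bar>im (Z n) - b\<bar> \<le> \<epsilon> *\<^sub>R w" using b[OF e] by blast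
    have "modulus (Z n - Cplx a b) \<le> \<epsilon> *\<^sub>R (v + w)" if "n \<ge> max N M" for n
    proof -
      have "modulus (Z n - Cplx a b) \<le> \<bar>re (Z n) - a\<bar> + \<bar>im (Z n) - b\<bar>"
        using U[of "Z n - Cplx a b"] by simp
      also have "\<dots> \<le> \<epsilon> *\<^sub>R v + \<epsilon> *\<^sub>R w" using N M that by (intro add_mono) auto
      finally show ?thesis by (simp add: scaleR_add_right)
    qed
    then show "\<exists>N. \<forall>n\<ge>N. modulus (Z n - Cplx a b) \<le> \<epsilon> *\<^sub>R (v + w)" by blast
  qed
  then show ?thesis by blast
qed

definition is_partition :: "nat \<Rightarrow> (nat \<Rightarrow> real) \<Rightarrow> real \<Rightarrow> bool" where
  "is_partition n p s \<longleftrightarrow> p 0 = 0 \<and> p n = s \<and> (\<forall>i\<in>{1..n}. p (i - 1) < p i)"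

definition has_ru_integral ::
    "(real \<Rightarrow> 'a::ru_complete_vector_lattice complexification) \<Rightarrow> 'a complexification \<Rightarrow> real \<Rightarrow> bool"
  where
  "has_ru_integral f I s \<longleftrightarrow>
     (\<exists>u\<ge>0. \<forall>\<epsilon>>0. \<exists>\<delta>>0. \<forall>n p t.
        is_partition n p s \<longrightarrow> (\<forall>i\<in>{1..n}. \<bar>p i - p (i - 1)\<bar> \<le> \<delta>) \<longrightarrow>
        (\<forall>i\<in>{1..n}. t i \<in> {p (i - 1)..p i}) \<longrightarrow>
        modulus ((\<Sum>i=1..n. complex_of_real (p i - p (i - 1)) *\<^sub>C f (t i)) - I) \<le> \<epsilon> *\<^sub>R u)"

definition ru_integrable ::
    "(real \<Rightarrow> 'a::ru_complete_vector_lattice complexification) \<Rightarrow> real \<Rightarrow> bool" where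
  "ru_integrable f s \<longleftrightarrow> (\<exists>I. has_ru_integral f I s)"

definition ru_integral ::
    "(real \<Rightarrow> 'a::ru_complete_vector_lattice complexification) \<Rightarrow> real \<Rightarrow> 'a complexification" where
  "ru_integral f s = (THE I. has_ru_integral f I s)"

definition improper_ru_integrable ::
    "(real \<Rightarrow> 'a::ru_complete_vector_lattice complexification) \<Rightarrow> bool" where
  "improper_ru_integrable f \<longleftrightarrow>
     (\<forall>s\<ge>0. ru_integrable f s) \<and> (\<exists>I. ru_tendsto (ru_integral f) I at_top)"

definition improper_ru_integral ::
    "(real \<Rightarrow> 'a::ru_complete_vector_lattice complexification) \<Rightarrow> 'a complexification" where
  "improper_ru_integral f = ru_Lim at_top (ru_integral f)"


section \<open>Semigroups\<close>

text \<open>Functions on the nonnegative half-line are functions on \<open>real\<close> of which only the values at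
  nonnegative arguments matter.\<close>

definition ru_continuous ::
    "(real \<Rightarrow> 'a::ru_complete_vector_lattice complexification) \<Rightarrow> bool" where
  "ru_continuous f \<longleftrightarrow>
     (\<exists>u::real \<Rightarrow> 'a. (\<forall>t\<ge>0. u t \<ge> 0) \<and>
        (\<forall>\<epsilon>>0. \<exists>\<delta>>0. \<forall>t\<ge>0. \<forall>h\<in>{- min \<delta> t..\<delta>}. modulus (f (t + h) - f t) \<le> \<epsilon> *\<^sub>R u t))"

definition ru_continuous_semigroup ::
    "(real \<Rightarrow> 'a::ru_complete_vector_lattice complexification \<Rightarrow> 'a complexification) \<Rightarrow> bool" where
  "ru_continuous_semigroup T \<longleftrightarrow>
     (\<forall>t\<ge>0. Vector_Spaces.linear scaleC scaleC (T t)) \<and>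
     T 0 = id \<and> (\<forall>s\<ge>0. \<forall>t\<ge>0. T (t + s) = T t \<circ> T s) \<and>
     (\<forall>x. ru_continuous (\<lambda>t. T t x))"

definition positive_semigroup ::
    "(real \<Rightarrow> 'a::ru_complete_vector_lattice complexification \<Rightarrow> 'a complexification) \<Rightarrow> bool" where
  "positive_semigroup T \<longleftrightarrow> (\<forall>t\<ge>0. positive_operator (T t))"

definition exponentially_order_bounded ::
    "(real \<Rightarrow> 'a::ru_complete_vector_lattice complexification \<Rightarrow> 'a complexification) \<Rightarrow> real \<Rightarrow> bool"
  where
  "exponentially_order_bounded T w \<longleftrightarrow>
     (\<forall>x. \<exists>u\<ge>0. \<forall>t\<ge>0. modulus (T t x) \<le> exp (w * t) *\<^sub>R u)"

abbreviation difference_quotient ::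
    "(real \<Rightarrow> 'a::ru_complete_vector_lattice complexification \<Rightarrow> 'a complexification) \<Rightarrow>
     'a complexification \<Rightarrow> real \<Rightarrow> 'a complexification" where
  "difference_quotient T x h \<equiv> complex_of_real (1 / h) *\<^sub>C (T h x - x)"

definition generator_domain ::
    "(real \<Rightarrow> 'a::ru_complete_vector_lattice complexification \<Rightarrow> 'a complexification) \<Rightarrow>
     'a complexification set" where
  "generator_domain T = {x. \<exists>y. ru_tendsto (difference_quotient T x) y (at_right 0)}"

text \<open>Only meaningful on \<^term>\<open>generator_domain T\<close>.\<close>

definition generator ::
    "(real \<Rightarrow> 'a::ru_complete_vector_lattice complexification \<Rightarrow> 'a complexification) \<Rightarrow>
     'a complexification \<Rightarrow> 'a complexification" where
  "generator T x = ru_Lim (at_right 0) (difference_quotient T x)"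


section \<open>Resolvents\<close>

text \<open>An unbounded operator is given by its domain \<open>D\<close> and a function \<open>A\<close>, considered on \<open>D\<close> only.\<close>

definition resolvent_exists ::
    "'a::ru_complete_vector_lattice complexification set \<Rightarrow>
     ('a complexification \<Rightarrow> 'a complexification) \<Rightarrow> complex \<Rightarrow> bool" where
  "resolvent_exists D A l \<longleftrightarrow> bij_betw (\<lambda>x. l *\<^sub>C x - A x) D UNIV"

definition resolvent ::
    "'a::ru_complete_vector_lattice complexification set \<Rightarrow>
     ('a complexification \<Rightarrow> 'a complexification) \<Rightarrow> complex \<Rightarrow>
     'a complexification \<Rightarrow> 'a complexification" where
  "resolvent D A l = inv_into D (\<lambda>x. l *\<^sub>C x - A x)"

definition positive_resolvent_set ::
    "'a::ru_complete_vector_lattice complexification set \<Rightarrow>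
     ('a complexification \<Rightarrow> 'a complexification) \<Rightarrow> complex set" where
  "positive_resolvent_set D A =
     {l. resolvent_exists D A l \<and> positive_operator (resolvent D A l)}"

definition laplace_integrand ::
    "(real \<Rightarrow> 'a::ru_complete_vector_lattice complexification \<Rightarrow> 'a complexification) \<Rightarrow>
     complex \<Rightarrow> 'a complexification \<Rightarrow> real \<Rightarrow> 'a complexification" where
  "laplace_integrand T l x t = exp (- l * complex_of_real t) *\<^sub>C T t x"

definition laplace_operator ::
    "(real \<Rightarrow> 'a::ru_complete_vector_lattice complexification \<Rightarrow> 'a complexification) \<Rightarrow>
     complex \<Rightarrow> 'a complexification \<Rightarrow> 'a complexification" where
  "laplace_operator T l x = improper_ru_integral (laplace_integrand T l x)"

end

theory Submission
  imports Defs
begin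

text \<open>The proof follows the classical argument for strongly continuous semigroups, with regulators in
  place of a norm. Three points have to be arranged differently.

  A single regulator. Ru-continuity of an orbit allows a regulator that depends on the time in an
  uncontrolled way, which is too weak for integration. Only the regulator at time \<open>0\<close> is used: from
  \<open>\<bar>T h x - x\<bar> \<le> \<epsilon> u\<close> positivity gives \<open>\<bar>T (t + h) x - T t x\<bar> \<le> \<epsilon> T t u\<close>, and the order exponent
  bounds \<open>T t u\<close> by \<open>exp (w t) v\<close>. Hence \<open>t \<mapsto> exp (- l t) T t x\<close> is uniformly continuous on the whole
  half-line with one regulator (\<open>laplace_integrand_uniformly_continuous\<close>).

  Primitives instead of integrals. A uniformly continuous function \<open>f\<close> has a primitive \<open>F\<close>, the limit
  of Euler polygons (\<open>ru_primitive_exists\<close>). All Riemann sums of fine mesh are then close to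
  \<open>F s - F 0\<close>, so \<open>F\<close> is the integral function (\<open>ru_primitive_has_integral\<close>). Primitives are unique up
  to constants and behave well under shifts, sums and order bounded operators, so
  additivity, linearity and exchange with \<open>T t\<close> all come from comparing primitives. A mean value
  inequality (\<open>increments_le\<close>) turns an exponential bound on \<open>f\<close> into convergence of \<open>F\<close> at infinity
  (\<open>ru_primitive_limit\<close>); the limit is the Laplace transform \<open>R l x\<close>.

  Powers. If \<open>\<bar>T t x\<bar> \<le> exp (w t) u\<close> for all \<open>t\<close>, then \<open>\<bar>T t (R l x)\<bar> \<le> exp (w t) u / (Re l - w)\<close> for all
  \<open>t\<close>, because \<open>T t\<close> commutes with \<open>R l\<close>. The bound has the same shape, so it can be iterated with the
  same \<open>u\<close> (\<open>laplace_operator_power_le\<close>).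

  Finally \<open>exp (- l h) T h (R l x) = R l x - (integral of exp (- l t) T t x over [0, h])\<close>
  (\<open>laplace_operator_shift\<close>). Dividing by \<open>h\<close> shows that \<open>R l x\<close> is in the domain of the generator \<open>A\<close>
  with \<open>A (R l x) = l R l x - x\<close>. Since \<open>R l\<close> is order bounded, it preserves ru-limits; as it
  commutes with the semigroup it therefore commutes with \<open>A\<close>, and so \<open>R l\<close> is also a left inverse of
  \<open>l - A\<close>.\<close>

section \<open>The modulus\<close>

lemma modulus_le_iff_all_angles:
  "modulus z \<le> m \<longleftrightarrow> (\<forall>\<theta>. \<bar>cos \<theta> *\<^sub>R re z + sin \<theta> *\<^sub>R im z\<bar> \<le> m)"
proof
  assume m: "modulus z \<le> m"
  show "\<forall>\<theta>. \<bar>cos \<theta> *\<^sub>R re z + sin \<theta> *\<^sub>R im z\<bar> \<le> m"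
  proof
    fix \<theta> :: real
    obtain t where "t \<in> {0..<2 * pi}" "cos \<theta> = cos t" "sin \<theta> = sin t"
      using sincos_total_2pi[of "cos \<theta>" "sin \<theta>"] by auto
    then show "\<bar>cos \<theta> *\<^sub>R re z + sin \<theta> *\<^sub>R im z\<bar> \<le> m"
      using m unfolding modulus_le_iff by metis
  qed
qed (simp add: modulus_le_iff)

lemma abs_rotation_le_modulus: "\<bar>cos \<theta> *\<^sub>R re z + sin \<theta> *\<^sub>R im z\<bar> \<le> modulus z"
  using modulus_le_iff_all_angles[of z "modulus z"] by simp

lemma abs_re_le_modulus: "\<bar>re z\<bar> \<le> modulus z"
  using abs_rotation_le_modulus[of 0 z] by simp

lemma abs_im_le_modulus: "\<bar>im z\<bar> \<le> modulus z"
  using abs_rotation_le_modulus[of "pi / 2" z] by simp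

lemma modulus_nonneg [simp]: "0 \<le> modulus z"
  using abs_re_le_modulus[of z] abs_ge_zero order_trans by blast

lemma modulus_zero [simp]: "modulus 0 = 0"
  by (rule antisym) (simp_all add: modulus_le_iff)

lemma modulus_of_real_le: "0 \<le> x \<Longrightarrow> modulus (Cplx x 0) \<le> x"
  unfolding modulus_le_iff_all_angles
  using abs_scaleR_le[of "cos _" 1 x] by simp

lemma modulus_add_le: "modulus (z + z') \<le> modulus z + modulus z'"
  unfolding modulus_le_iff_all_angles
proof
  fix \<theta> :: real
  have "\<bar>cos \<theta> *\<^sub>R re (z + z') + sin \<theta> *\<^sub>R im (z + z')\<bar>
      = \<bar>(cos \<theta> *\<^sub>R re z + sin \<theta> *\<^sub>R im z) + (cos \<theta> *\<^sub>R re z' + sin \<theta> *\<^sub>R im z')\<bar>"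
    by (simp add: algebra_simps)
  also have "\<dots> \<le> modulus z + modulus z'"
    by (rule order_trans[OF abs_triangle_ineq]) (intro add_mono abs_rotation_le_modulus)
  finally show "\<bar>cos \<theta> *\<^sub>R re (z + z') + sin \<theta> *\<^sub>R im (z + z')\<bar> \<le> modulus z + modulus z'" .
qed

text \<open>Multiplication by \<open>c = r exp (i \<phi>)\<close> shifts all angles by \<open>\<phi>\<close>.\<close>

lemma modulus_scaleC_le: "modulus (c *\<^sub>C z) \<le> cmod c *\<^sub>R modulus z"
  unfolding modulus_le_iff_all_angles
proof
  fix \<theta> :: real
  define \<phi> where "\<phi> = Arg c"
  have c: "Re c = cmod c * cos \<phi>" "Im c = cmod c * sin \<phi>"
    using Re_rcis[of "cmod c" "Arg c"] Im_rcis[of "cmod c" "Arg c"] by (simp_all only: rcis_cmod_Arg \<phi>_def)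
  have "cos \<theta> *\<^sub>R re (c *\<^sub>C z) + sin \<theta> *\<^sub>R im (c *\<^sub>C z)
      = cmod c *\<^sub>R (cos (\<theta> - \<phi>) *\<^sub>R re z + sin (\<theta> - \<phi>) *\<^sub>R im z)"
    by (simp add: c cos_diff sin_diff algebra_simps)
  also have "\<bar>\<dots>\<bar> \<le> cmod c *\<^sub>R \<bar>cos (\<theta> - \<phi>) *\<^sub>R re z + sin (\<theta> - \<phi>) *\<^sub>R im z\<bar>"
    by (rule abs_scaleR_le) simp
  also have "\<dots> \<le> cmod c *\<^sub>R modulus z"
    by (intro scaleR_left_mono abs_rotation_le_modulus) simp
  finally show "\<bar>cos \<theta> *\<^sub>R re (c *\<^sub>C z) + sin \<theta> *\<^sub>R im (c *\<^sub>C z)\<bar> \<le> cmod c *\<^sub>R modulus z" .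
qed

lemma modulus_minus [simp]: "modulus (- z) = modulus z"
proof -
  have "- z = (- 1) *\<^sub>C z" for z :: "'a complexification"
    by (simp add: complexification.expand)
  then have "modulus (- z) \<le> modulus z" for z :: "'a complexification"
    using modulus_scaleC_le[of "- 1" z] by simp
  from this[of z] this[of "- z"] show ?thesis by simp
qed

lemma modulus_minus_commute: "modulus (z - z') = modulus (z' - z)"
  using modulus_minus[of "z - z'"] by simp

lemma modulus_diff_le: "modulus (z - z') \<le> modulus z + modulus z'"
  using modulus_add_le[of z "- z'"] by simp

lemma modulus_add_mono:
  "modulus z \<le> u \<Longrightarrow> modulus z' \<le> u' \<Longrightarrow> modulus (z + z') \<le> u + u'"
  by (meson add_mono modulus_add_le order_trans)

lemma modulus_diff_mono:
  "modulus z \<le> u \<Longrightarrow> modulus z' \<le> u' \<Longrightarrow> modulus (z - z') \<le> u + u'"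
  by (meson add_mono modulus_diff_le order_trans)

lemma modulus_scaleC_mono:
  assumes "cmod c \<le> r" "modulus z \<le> u"
  shows "modulus (c *\<^sub>C z) \<le> r *\<^sub>R u"
proof -
  have "modulus (c *\<^sub>C z) \<le> cmod c *\<^sub>R modulus z" by (rule modulus_scaleC_le)
  also have "\<dots> \<le> r *\<^sub>R modulus z" using assms by (intro scaleR_right_mono) auto
  also have "\<dots> \<le> r *\<^sub>R u"
    using assms norm_ge_zero order_trans by (intro scaleR_left_mono) blast+
  finally show ?thesis .
qed

lemma modulus_sum_le: "modulus (\<Sum>i\<in>A. z i) \<le> (\<Sum>i\<in>A. modulus (z i))"
proof (induction A rule: infinite_finite_induct)
  case (insert i A)
  then show ?case by (simp add: modulus_add_mono)
qed auto

lemma modulus_le_0D: "modulus z \<le> 0 \<Longrightarrow> z = 0"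
  using abs_re_le_modulus[of z] abs_im_le_modulus[of z]
  by (metis abs_le_zero_iff complexification.expand order_trans re_im_simps(1,2))

lemma modulus_le_if_approx:
  assumes "0 \<le> u" "\<And>\<epsilon>. \<epsilon> > 0 \<Longrightarrow> modulus z \<le> m + \<epsilon> *\<^sub>R u"
  shows "modulus z \<le> m"
  using archimedean_le assms by blast

section \<open>Relative uniform limits\<close>

lemma ru_tendstoI:
  "0 \<le> u \<Longrightarrow> (\<And>\<epsilon>. \<epsilon> > 0 \<Longrightarrow> \<forall>\<^sub>F a in F. modulus (f a - l) \<le> \<epsilon> *\<^sub>R u) \<Longrightarrow> ru_tendsto f l F"
  unfolding ru_tendsto_def by blast

lemma ru_tendstoE:
  assumes "ru_tendsto f l F"
  obtains u where "0 \<le> u" "\<And>\<epsilon>. \<epsilon> > 0 \<Longrightarrow> \<forall>\<^sub>F a in F. modulus (f a - l) \<le> \<epsilon> *\<^sub>R u"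
  using assms unfolding ru_tendsto_def by blast

lemma ru_tendsto_cong:
  assumes "ru_tendsto f l F" "\<forall>\<^sub>F a in F. g a = f a"
  shows "ru_tendsto g l F"
proof -
  obtain u where u: "0 \<le> u" "\<And>\<epsilon>. \<epsilon> > 0 \<Longrightarrow> \<forall>\<^sub>F a in F. modulus (f a - l) \<le> \<epsilon> *\<^sub>R u"
    using assms(1) by (rule ru_tendstoE) blast
  show ?thesis
  proof (rule ru_tendstoI[OF u(1)])
    fix \<epsilon> :: real assume "\<epsilon> > 0"
    from assms(2) u(2)[OF this] show "\<forall>\<^sub>F a in F. modulus (g a - l) \<le> \<epsilon> *\<^sub>R u"
      by eventually_elim simp
  qed
qed

lemma ru_tendsto_modulus_le:
  assumes "ru_tendsto f l F" "F \<noteq> bot" "\<forall>\<^sub>F a in F. modulus (f a) \<le> m"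
  shows "modulus l \<le> m"
proof -
  obtain u where u: "0 \<le> u" "\<And>\<epsilon>. \<epsilon> > 0 \<Longrightarrow> \<forall>\<^sub>F a in F. modulus (f a - l) \<le> \<epsilon> *\<^sub>R u"
    using assms(1) by (rule ru_tendstoE) blast
  show ?thesis
  proof (rule modulus_le_if_approx[OF u(1)])
    fix \<epsilon> :: real assume "\<epsilon> > 0"
    from assms(3) u(2)[OF this] have "\<forall>\<^sub>F a in F. modulus l \<le> m + \<epsilon> *\<^sub>R u"
    proof eventually_elim
      case (elim a)
      then show ?case using modulus_diff_mono[of "f a" m "f a - l"] by simp
    qed
    then show "modulus l \<le> m + \<epsilon> *\<^sub>R u" using assms(2) eventually_const by metis
  qed
qed

lemma ru_tendsto_const [simp]: "ru_tendsto (\<lambda>_. l) l F"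
  by (rule ru_tendstoI[of 0]) simp_all

lemma ru_tendsto_add:
  assumes "ru_tendsto f l F" "ru_tendsto g m F"
  shows "ru_tendsto (\<lambda>a. f a + g a) (l + m) F"
proof -
  obtain u where u: "0 \<le> u" "\<And>\<epsilon>. \<epsilon> > 0 \<Longrightarrow> \<forall>\<^sub>F a in F. modulus (f a - l) \<le> \<epsilon> *\<^sub>R u"
    using assms(1) by (rule ru_tendstoE) blast
  obtain v where v: "0 \<le> v" "\<And>\<epsilon>. \<epsilon> > 0 \<Longrightarrow> \<forall>\<^sub>F a in F. modulus (g a - m) \<le> \<epsilon> *\<^sub>R v"
    using assms(2) by (rule ru_tendstoE) blast
  show ?thesis
  proof (rule ru_tendstoI[of "u + v"])
    fix \<epsilon> :: real assume "\<epsilon> > 0"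
    from u(2)[OF this] v(2)[OF this]
    show "\<forall>\<^sub>F a in F. modulus (f a + g a - (l + m)) \<le> \<epsilon> *\<^sub>R (u + v)"
    proof eventually_elim
      case (elim a)
      from modulus_add_mono[OF this] show ?case by (simp add: algebra_simps)
    qed
  qed (use u v in simp)
qed

lemma ru_tendsto_scaleC:
  assumes "(c \<longlongrightarrow> d) F" "ru_tendsto f l F"
  shows "ru_tendsto (\<lambda>a. c a *\<^sub>C f a) (d *\<^sub>C l) F"
proof -
  obtain u where u: "0 \<le> u" "\<And>\<epsilon>. \<epsilon> > 0 \<Longrightarrow> \<forall>\<^sub>F a in F. modulus (f a - l) \<le> \<epsilon> *\<^sub>R u"
    using assms(2) by (rule ru_tendstoE) blast
  show ?thesis
  proof (rule ru_tendstoI[of "(cmod d + 1) *\<^sub>R u + modulus l"])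
    show "0 \<le> (cmod d + 1) *\<^sub>R u + modulus l" using u by (simp add: scaleR_nonneg_nonneg)
    fix \<epsilon> :: real assume e: "\<epsilon> > 0"
    have "\<forall>\<^sub>F a in F. cmod (c a - d) < \<epsilon>" "\<forall>\<^sub>F a in F. cmod (c a - d) < 1"
      using assms(1) e by (auto simp: tendsto_iff dist_norm)
    with u(2)[OF e]
    show "\<forall>\<^sub>F a in F. modulus (c a *\<^sub>C f a - d *\<^sub>C l) \<le> \<epsilon> *\<^sub>R ((cmod d + 1) *\<^sub>R u + modulus l)"
    proof eventually_elim
      case (elim a)
      have "c a *\<^sub>C f a - d *\<^sub>C l = c a *\<^sub>C (f a - l) + (c a - d) *\<^sub>C l"
        by (simp add: complexification.scale_right_diff_distrib complexification.scale_left_diff_distrib)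
      moreover have "cmod (c a) \<le> cmod d + 1"
        using elim norm_triangle_ineq2[of "c a" d] by linarith
      then have "modulus (c a *\<^sub>C (f a - l)) \<le> (cmod d + 1) *\<^sub>R \<epsilon> *\<^sub>R u"
        using elim by (intro modulus_scaleC_mono)
      moreover have "modulus ((c a - d) *\<^sub>C l) \<le> \<epsilon> *\<^sub>R modulus l"
        using elim by (intro modulus_scaleC_mono) auto
      ultimately have "modulus (c a *\<^sub>C f a - d *\<^sub>C l) \<le> (cmod d + 1) *\<^sub>R \<epsilon> *\<^sub>R u + \<epsilon> *\<^sub>R modulus l"
        using modulus_add_mono by metis
      then show ?case by (simp add: scaleR_add_right mult.commute)
    qed
  qed
qed

lemma ru_tendsto_diff:
  assumes "ru_tendsto f l F" "ru_tendsto g m F"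
  shows "ru_tendsto (\<lambda>a. f a - g a) (l - m) F"
  using ru_tendsto_add[OF assms(1) ru_tendsto_scaleC[OF tendsto_const[of "- 1"] assms(2)]]
  by simp

lemma ru_tendsto_unique:
  assumes "ru_tendsto f l F" "ru_tendsto f m F" "F \<noteq> bot"
  shows "l = m"
proof -
  have "modulus (l - m) \<le> 0"
    using ru_tendsto_modulus_le[OF ru_tendsto_diff[OF assms(1,2)] assms(3), of 0] by simp
  then show ?thesis using modulus_le_0D by force
qed

lemma ru_LimI: "ru_tendsto f l F \<Longrightarrow> F \<noteq> bot \<Longrightarrow> ru_Lim F f = l"
  unfolding ru_Lim_def using ru_tendsto_unique by blast

lemma ru_tendsto_compose:
  "ru_tendsto f l G \<Longrightarrow> filterlim g G F \<Longrightarrow> ru_tendsto (\<lambda>a. f (g a)) l F"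
  unfolding ru_tendsto_def filterlim_iff by blast

section \<open>Order bounded operators\<close>

definition order_bounded ::
    "('a::ru_complete_vector_lattice complexification \<Rightarrow> 'a complexification) \<Rightarrow> bool" where
  "order_bounded B \<longleftrightarrow> Vector_Spaces.linear scaleC scaleC B \<and>
     (\<forall>u\<ge>0. \<exists>v\<ge>0. \<forall>z. modulus z \<le> u \<longrightarrow> modulus (B z) \<le> v)"

lemma linear_ops:
  assumes "Vector_Spaces.linear scaleC scaleC B"
  shows "B (x + y) = B x + B y" "B (x - y) = B x - B y" "B (c *\<^sub>C x) = c *\<^sub>C B x" "B 0 = 0"
proof -
  interpret Vector_Spaces.linear scaleC scaleC B by fact
  show "B (x + y) = B x + B y" "B (x - y) = B x - B y" "B (c *\<^sub>C x) = c *\<^sub>C B x" "B 0 = 0"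
    by (simp_all add: add diff scale)
qed

lemma linearI:
  assumes "\<And>x y. B (x + y) = B x + B y" "\<And>c x. B (c *\<^sub>C x) = c *\<^sub>C B x"
  shows "Vector_Spaces.linear scaleC scaleC B"
  using assms by unfold_locales auto

text \<open>The bound of an order bounded operator scales with the size of its argument, so that an
  \<open>\<epsilon>\<close>-estimate is turned into an \<open>\<epsilon>\<close>-estimate.\<close>

lemma order_boundedE:
  assumes "order_bounded B" "0 \<le> u"
  obtains v where "0 \<le> v"
    "\<And>\<epsilon> z. 0 \<le> \<epsilon> \<Longrightarrow> modulus z \<le> \<epsilon> *\<^sub>R u \<Longrightarrow> modulus (B z) \<le> \<epsilon> *\<^sub>R v"
proof -
  have lin: "Vector_Spaces.linear scaleC scaleC B"
    using assms by (simp add: order_bounded_def)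
  obtain v where v: "0 \<le> v" "\<And>z. modulus z \<le> u \<Longrightarrow> modulus (B z) \<le> v"
    using assms unfolding order_bounded_def by blast
  have "modulus (B z) \<le> \<epsilon> *\<^sub>R v" if "0 \<le> \<epsilon>" "modulus z \<le> \<epsilon> *\<^sub>R u" for \<epsilon> z
  proof (cases "\<epsilon> = 0")
    case True
    then have "z = 0" using that modulus_le_0D by auto
    with True show ?thesis using linear_ops(4)[OF lin] by simp
  next
    case False
    define z' where "z' = complex_of_real (1 / \<epsilon>) *\<^sub>C z"
    have "modulus z' \<le> (1 / \<epsilon>) *\<^sub>R \<epsilon> *\<^sub>R u"
      unfolding z'_def using that by (intro modulus_scaleC_mono) (auto simp: norm_divide)
    with False have "modulus z' \<le> u" by simp
    moreover have "z = complex_of_real \<epsilon> *\<^sub>C z'" using False by (simp add: z'_def)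
    ultimately show ?thesis
      using that v by (simp add: linear_ops[OF lin] modulus_scaleC_mono)
  qed
  with v show ?thesis using that by blast
qed

lemma order_bounded_ru_tendsto:
  assumes "order_bounded B" "ru_tendsto f l F"
  shows "ru_tendsto (\<lambda>a. B (f a)) (B l) F"
proof -
  obtain u where u: "0 \<le> u" "\<And>\<epsilon>. \<epsilon> > 0 \<Longrightarrow> \<forall>\<^sub>F a in F. modulus (f a - l) \<le> \<epsilon> *\<^sub>R u"
    using assms(2) by (rule ru_tendstoE) blast
  obtain v where v: "0 \<le> v"
    "\<And>\<epsilon> z. 0 \<le> \<epsilon> \<Longrightarrow> modulus z \<le> \<epsilon> *\<^sub>R u \<Longrightarrow> modulus (B z) \<le> \<epsilon> *\<^sub>R v"
    using order_boundedE[OF assms(1) u(1)] by blast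
  have lin: "Vector_Spaces.linear scaleC scaleC B"
    using assms by (simp add: order_bounded_def)
  show ?thesis
  proof (rule ru_tendstoI[OF v(1)])
    fix \<epsilon> :: real assume "\<epsilon> > 0"
    with u(2)[OF this] show "\<forall>\<^sub>F a in F. modulus (B (f a) - B l) \<le> \<epsilon> *\<^sub>R v"
      by (auto elim!: eventually_mono simp flip: linear_ops[OF lin] intro: v(2))
  qed
qed

text \<open>A positive operator sends real elements to real elements, so that it commutes with the
  formation of \<open>cos \<theta> x + sin \<theta> y\<close>; this gives \<open>\<bar>B z\<bar> \<le> B \<bar>z\<bar>\<close> also for complex \<open>z\<close>.\<close>

lemma positive_operator_modulus_le:
  assumes B: "positive_operator B" and z: "modulus z \<le> u"
  shows "modulus (B z) \<le> re (B (Cplx u 0))"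
proof -
  have lin: "Vector_Spaces.linear scaleC scaleC B" using B by (simp add: positive_operator_def)
  have pos: "im (B (Cplx x 0)) = 0" "0 \<le> re (B (Cplx x 0))" if "0 \<le> x" for x
  proof -
    have "B (Cplx x 0) \<in> positive_cone"
      using B that unfolding positive_operator_def positive_cone_def by blast
    then show "im (B (Cplx x 0)) = 0" "0 \<le> re (B (Cplx x 0))" by (auto simp: positive_cone_def)
  qed
  have u: "0 \<le> u" using z modulus_nonneg order_trans by blast
  have real: "im (B (Cplx r 0)) = 0" "\<bar>re (B (Cplx r 0))\<bar> \<le> re (B (Cplx u 0))" if r: "\<bar>r\<bar> \<le> u" for r
  proof -
    have "Cplx (u - r) 0 = Cplx u 0 - Cplx r 0" "Cplx (u + r) 0 = Cplx u 0 + Cplx r 0"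
      by (simp_all add: complexification.expand)
    then have B: "B (Cplx (u - r) 0) = B (Cplx u 0) - B (Cplx r 0)"
      "B (Cplx (u + r) 0) = B (Cplx u 0) + B (Cplx r 0)"
      by (simp_all add: linear_ops[OF lin])
    have "r \<le> u" "- r \<le> u"
      using r abs_ge_self[of r] abs_ge_minus_self[of r] order_trans by blast+
    then have "0 \<le> u - r" "0 \<le> u + r"
      using diff_ge_0_iff_ge[of u r] diff_ge_0_iff_ge[of u "- r"] by simp_all
    note pos = pos[OF this(1), unfolded B] pos[OF this(2), unfolded B] pos[OF u]
    show "im (B (Cplx r 0)) = 0" using pos by simp
    show "\<bar>re (B (Cplx r 0))\<bar> \<le> re (B (Cplx u 0))"
    proof (rule abs_leI)
      show "re (B (Cplx r 0)) \<le> re (B (Cplx u 0))" using pos by simp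
      show "- re (B (Cplx r 0)) \<le> re (B (Cplx u 0))"
        using pos diff_ge_0_iff_ge[of "re (B (Cplx u 0))" "- re (B (Cplx r 0))"] by simp
    qed
  qed
  have "\<bar>re z\<bar> \<le> u" "\<bar>im z\<bar> \<le> u"
    using z abs_re_le_modulus abs_im_le_modulus order_trans by blast+
  note im0 = real(1)[OF this(1)] real(1)[OF this(2)]
  have "z = Cplx (re z) 0 + \<i> *\<^sub>C Cplx (im z) 0" by (simp add: complexification.expand)
  then have "B z = B (Cplx (re z) 0) + \<i> *\<^sub>C B (Cplx (im z) 0)"
    using linear_ops[OF lin] by metis
  then have Bz: "re (B z) = re (B (Cplx (re z) 0))" "im (B z) = re (B (Cplx (im z) 0))"
    using im0 by simp_all
  show ?thesis
    unfolding modulus_le_iff_all_angles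
  proof
    fix \<theta> :: real
    define r where "r = cos \<theta> *\<^sub>R re z + sin \<theta> *\<^sub>R im z"
    have "Cplx r 0 = complex_of_real (cos \<theta>) *\<^sub>C Cplx (re z) 0 + complex_of_real (sin \<theta>) *\<^sub>C Cplx (im z) 0"
      by (simp add: complexification.expand r_def)
    then have "B (Cplx r 0) = complex_of_real (cos \<theta>) *\<^sub>C B (Cplx (re z) 0)
        + complex_of_real (sin \<theta>) *\<^sub>C B (Cplx (im z) 0)"
      by (simp only: linear_ops[OF lin])
    then have "re (B (Cplx r 0)) = cos \<theta> *\<^sub>R re (B z) + sin \<theta> *\<^sub>R im (B z)"
      by (simp add: Bz)
    moreover have "\<bar>r\<bar> \<le> u"
      using abs_rotation_le_modulus[of \<theta> z] z unfolding r_def by (rule order_trans)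
    ultimately show "\<bar>cos \<theta> *\<^sub>R re (B z) + sin \<theta> *\<^sub>R im (B z)\<bar> \<le> re (B (Cplx u 0))"
      using real(2) by metis
  qed
qed

lemma positive_operator_order_bounded:
  assumes "positive_operator B"
  shows "order_bounded B"
  unfolding order_bounded_def
proof (intro conjI allI impI)
  show "Vector_Spaces.linear scaleC scaleC B" using assms by (simp add: positive_operator_def)
  fix u :: 'a assume "0 \<le> u"
  then have "modulus (Cplx u 0) \<le> u" by (rule modulus_of_real_le)
  show "\<exists>v\<ge>0. \<forall>z. modulus z \<le> u \<longrightarrow> modulus (B z) \<le> v"
    using positive_operator_modulus_le[OF assms] modulus_nonneg order_trans \<open>modulus (Cplx u 0) \<le> u\<close>
    by blast
qed

section \<open>Primitives and Riemann integrals\<close>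

text \<open>The derivative of \<open>F\<close> is \<open>f\<close>, uniformly on the half-line and with one regulator. The derivative is
  taken at an arbitrary point \<open>t\<close> between \<open>a\<close> and \<open>b\<close>, which matches the tags of Riemann sums.\<close>

definition ru_primitive ::
    "(real \<Rightarrow> 'a::ru_complete_vector_lattice complexification) \<Rightarrow>
     (real \<Rightarrow> 'a complexification) \<Rightarrow> bool" where
  "ru_primitive F f \<longleftrightarrow> (\<exists>u\<ge>0. \<forall>\<epsilon>>0. \<exists>\<delta>>0. \<forall>a t b.
     0 \<le> a \<longrightarrow> a \<le> t \<longrightarrow> t \<le> b \<longrightarrow> b - a \<le> \<delta> \<longrightarrow>
     modulus (F b - F a - complex_of_real (b - a) *\<^sub>C f t) \<le> (\<epsilon> * (b - a)) *\<^sub>R u)"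

lemma ru_primitiveE:
  assumes "ru_primitive F f"
  obtains u where "0 \<le> u" "\<And>\<epsilon>. \<epsilon> > 0 \<Longrightarrow> \<exists>\<delta>>0. \<forall>a t b. 0 \<le> a \<longrightarrow> a \<le> t \<longrightarrow> t \<le> b \<longrightarrow> b - a \<le> \<delta> \<longrightarrow>
     modulus (F b - F a - complex_of_real (b - a) *\<^sub>C f t) \<le> (\<epsilon> * (b - a)) *\<^sub>R u"
  using assms unfolding ru_primitive_def by blast

lemma ru_primitive_cong:
  assumes "ru_primitive F f" "\<And>t. 0 \<le> t \<Longrightarrow> f t = g t"
  shows "ru_primitive F g"
proof -
  have "0 \<le> a \<Longrightarrow> a \<le> t \<Longrightarrow> g t = f t" for a t using assms(2)[of t] by simp
  then show ?thesis using assms(1) unfolding ru_primitive_def by (smt (verit))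
qed

lemma ru_primitive_shift:
  assumes "ru_primitive F f" "0 \<le> h"
  shows "ru_primitive (\<lambda>t. F (h + t)) (\<lambda>t. f (h + t))"
proof -
  obtain u where u: "0 \<le> u" and p: "\<And>\<epsilon>. \<epsilon> > 0 \<Longrightarrow> \<exists>\<delta>>0. \<forall>a t b. 0 \<le> a \<longrightarrow> a \<le> t \<longrightarrow> t \<le> b \<longrightarrow> b - a \<le> \<delta> \<longrightarrow>
     modulus (F b - F a - complex_of_real (b - a) *\<^sub>C f t) \<le> (\<epsilon> * (b - a)) *\<^sub>R u"
    using assms(1) by (rule ru_primitiveE) blast
  show ?thesis
    unfolding ru_primitive_def
  proof (intro exI[of _ u] conjI u allI impI)
    fix \<epsilon> :: real assume "\<epsilon> > 0"
    then obtain \<delta> where "\<delta> > 0" and d: "\<And>a t b. 0 \<le> a \<Longrightarrow> a \<le> t \<Longrightarrow> t \<le> b \<Longrightarrow> b - a \<le> \<delta> \<Longrightarrow>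
     modulus (F b - F a - complex_of_real (b - a) *\<^sub>C f t) \<le> (\<epsilon> * (b - a)) *\<^sub>R u"
      using p by blast
    show "\<exists>\<delta>>0. \<forall>a t b. 0 \<le> a \<longrightarrow> a \<le> t \<longrightarrow> t \<le> b \<longrightarrow> b - a \<le> \<delta> \<longrightarrow>
       modulus (F (h + b) - F (h + a) - complex_of_real (b - a) *\<^sub>C f (h + t)) \<le> (\<epsilon> * (b - a)) *\<^sub>R u"
    proof (intro exI[of _ \<delta>] conjI allI impI)
      fix a t b assume "0 \<le> a" "a \<le> t" "t \<le> b" "b - a \<le> \<delta>"
      then show "modulus (F (h + b) - F (h + a) - complex_of_real (b - a) *\<^sub>C f (h + t)) \<le> (\<epsilon> * (b - a)) *\<^sub>R u"
        using d[of "h + a" "h + t" "h + b"] assms(2) by simp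
    qed fact
  qed
qed

lemma ru_primitive_add:
  assumes "ru_primitive F f" "ru_primitive G g"
  shows "ru_primitive (\<lambda>t. F t + G t) (\<lambda>t. f t + g t)"
proof -
  obtain u where u: "0 \<le> u" and p: "\<And>\<epsilon>. \<epsilon> > 0 \<Longrightarrow> \<exists>\<delta>>0. \<forall>a t b. 0 \<le> a \<longrightarrow> a \<le> t \<longrightarrow> t \<le> b \<longrightarrow> b - a \<le> \<delta> \<longrightarrow>
     modulus (F b - F a - complex_of_real (b - a) *\<^sub>C f t) \<le> (\<epsilon> * (b - a)) *\<^sub>R u"
    using assms(1) by (rule ru_primitiveE) blast
  obtain v where v: "0 \<le> v" and q: "\<And>\<epsilon>. \<epsilon> > 0 \<Longrightarrow> \<exists>\<delta>>0. \<forall>a t b. 0 \<le> a \<longrightarrow> a \<le> t \<longrightarrow> t \<le> b \<longrightarrow> b - a \<le> \<delta> \<longrightarrow>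
     modulus (G b - G a - complex_of_real (b - a) *\<^sub>C g t) \<le> (\<epsilon> * (b - a)) *\<^sub>R v"
    using assms(2) by (rule ru_primitiveE) blast
  show ?thesis
    unfolding ru_primitive_def
  proof (intro exI[of _ "u + v"] conjI allI impI)
    show "0 \<le> u + v" using u v by simp
    fix \<epsilon> :: real assume e: "\<epsilon> > 0"
    obtain \<delta> where "\<delta> > 0" and d: "\<And>a t b. 0 \<le> a \<Longrightarrow> a \<le> t \<Longrightarrow> t \<le> b \<Longrightarrow> b - a \<le> \<delta> \<Longrightarrow>
     modulus (F b - F a - complex_of_real (b - a) *\<^sub>C f t) \<le> (\<epsilon> * (b - a)) *\<^sub>R u"
      using p[OF e] by blast
    obtain \<delta>' where "\<delta>' > 0" and d': "\<And>a t b. 0 \<le> a \<Longrightarrow> a \<le> t \<Longrightarrow> t \<le> b \<Longrightarrow> b - a \<le> \<delta>' \<Longrightarrow>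
     modulus (G b - G a - complex_of_real (b - a) *\<^sub>C g t) \<le> (\<epsilon> * (b - a)) *\<^sub>R v"
      using q[OF e] by blast
    show "\<exists>\<delta>>0. \<forall>a t b. 0 \<le> a \<longrightarrow> a \<le> t \<longrightarrow> t \<le> b \<longrightarrow> b - a \<le> \<delta> \<longrightarrow>
       modulus (F b + G b - (F a + G a) - complex_of_real (b - a) *\<^sub>C (f t + g t)) \<le> (\<epsilon> * (b - a)) *\<^sub>R (u + v)"
    proof (intro exI[of _ "min \<delta> \<delta>'"] conjI allI impI)
      fix a t b assume "0 \<le> a" "a \<le> t" "t \<le> b" "b - a \<le> min \<delta> \<delta>'"
      then show "modulus (F b + G b - (F a + G a) - complex_of_real (b - a) *\<^sub>C (f t + g t)) \<le> (\<epsilon> * (b - a)) *\<^sub>R (u + v)"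
        using modulus_add_mono[OF d[of a t b] d'[of a t b]]
        by (simp add: algebra_simps complexification.scale_right_distrib)
    qed (use \<open>\<delta> > 0\<close> \<open>\<delta>' > 0\<close> in simp)
  qed
qed

lemma ru_primitive_order_bounded:
  assumes "order_bounded B" "ru_primitive F f"
  shows "ru_primitive (\<lambda>t. B (F t)) (\<lambda>t. B (f t))"
proof -
  obtain u where u: "0 \<le> u" and p: "\<And>\<epsilon>. \<epsilon> > 0 \<Longrightarrow> \<exists>\<delta>>0. \<forall>a t b. 0 \<le> a \<longrightarrow> a \<le> t \<longrightarrow> t \<le> b \<longrightarrow> b - a \<le> \<delta> \<longrightarrow>
     modulus (F b - F a - complex_of_real (b - a) *\<^sub>C f t) \<le> (\<epsilon> * (b - a)) *\<^sub>R u"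
    using assms(2) by (rule ru_primitiveE) blast
  obtain v where v: "0 \<le> v"
    "\<And>\<epsilon> z. 0 \<le> \<epsilon> \<Longrightarrow> modulus z \<le> \<epsilon> *\<^sub>R u \<Longrightarrow> modulus (B z) \<le> \<epsilon> *\<^sub>R v"
    using order_boundedE[OF assms(1) u(1)] by blast
  have lin: "Vector_Spaces.linear scaleC scaleC B"
    using assms by (simp add: order_bounded_def)
  show ?thesis
    unfolding ru_primitive_def
  proof (intro exI[of _ v] conjI v(1) allI impI)
    fix \<epsilon> :: real assume e: "\<epsilon> > 0"
    then obtain \<delta> where "\<delta> > 0" and d: "\<And>a t b. 0 \<le> a \<Longrightarrow> a \<le> t \<Longrightarrow> t \<le> b \<Longrightarrow> b - a \<le> \<delta> \<Longrightarrow>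
     modulus (F b - F a - complex_of_real (b - a) *\<^sub>C f t) \<le> (\<epsilon> * (b - a)) *\<^sub>R u"
      using p by blast
    show "\<exists>\<delta>>0. \<forall>a t b. 0 \<le> a \<longrightarrow> a \<le> t \<longrightarrow> t \<le> b \<longrightarrow> b - a \<le> \<delta> \<longrightarrow>
       modulus (B (F b) - B (F a) - complex_of_real (b - a) *\<^sub>C B (f t)) \<le> (\<epsilon> * (b - a)) *\<^sub>R v"
    proof (intro exI[of _ \<delta>] conjI allI impI)
      fix a t b assume "0 \<le> a" "a \<le> t" "t \<le> b" "b - a \<le> \<delta>"
      then show "modulus (B (F b) - B (F a) - complex_of_real (b - a) *\<^sub>C B (f t)) \<le> (\<epsilon> * (b - a)) *\<^sub>R v"
        using v(2)[OF _ d[of a t b]] e by (simp add: linear_ops[OF lin])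
    qed fact
  qed
qed

lemma order_bounded_scaleC: "order_bounded (\<lambda>z. c *\<^sub>C z)"
  unfolding order_bounded_def
proof (intro conjI allI impI)
  show "Vector_Spaces.linear scaleC scaleC ((*\<^sub>C) c)"
    by (rule linearI) (simp_all add: complexification.scale_right_distrib mult.commute)
  fix u :: 'a assume "0 \<le> u"
  then show "\<exists>v\<ge>0. \<forall>z. modulus z \<le> u \<longrightarrow> modulus (c *\<^sub>C z) \<le> v"
    using modulus_scaleC_mono[of c "cmod c" _ u]
    by (intro exI[of _ "cmod c *\<^sub>R u"]) (auto simp: scaleR_nonneg_nonneg)
qed

text \<open>A mean value inequality: the left side is subadditive and the right side additive over adjacent
  intervals, so short intervals suffice.\<close>

lemma increments_le:
  fixes \<delta> :: real
  assumes "\<delta> > 0"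
    and short: "\<And>a b. 0 \<le> a \<Longrightarrow> a \<le> b \<Longrightarrow> b - a \<le> \<delta> \<Longrightarrow> modulus (G b - G a) \<le> g b - g a"
    and "0 \<le> a" "a \<le> b"
  shows "modulus (G b - G a) \<le> g b - g a"
proof -
  have "b - a \<le> real n * \<delta> \<Longrightarrow> a \<le> b \<Longrightarrow> modulus (G b - G a) \<le> g b - g a" for n b
  proof (induction n arbitrary: b)
    case 0
    then have "b = a" by simp
    then show ?case by simp
  next
    case (Suc n)
    define c where "c = max a (b - \<delta>)"
    have "c - a \<le> real n * \<delta>" "a \<le> c" "c \<le> b" "b - c \<le> \<delta>"
      using Suc.prems \<open>\<delta> > 0\<close> by (auto simp: c_def max_def algebra_simps)
    then have "modulus (G c - G a) \<le> g c - g a" "modulus (G b - G c) \<le> g b - g c"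
      using Suc.IH short \<open>0 \<le> a\<close> by auto
    from modulus_add_mono[OF this] show ?case by simp
  qed
  moreover obtain n where "(b - a) / \<delta> \<le> real n" using real_arch_simple by blast
  then have "b - a \<le> real n * \<delta>" using \<open>\<delta> > 0\<close> by (simp add: field_simps)
  ultimately show ?thesis using \<open>a \<le> b\<close> by blast
qed

definition ru_uniformly_continuous ::
    "(real \<Rightarrow> 'a::ru_complete_vector_lattice complexification) \<Rightarrow> bool" where
  "ru_uniformly_continuous f \<longleftrightarrow> (\<exists>u\<ge>0. \<forall>\<epsilon>>0. \<exists>\<delta>>0. \<forall>s t.
     0 \<le> s \<longrightarrow> s \<le> t \<longrightarrow> t - s \<le> \<delta> \<longrightarrow> modulus (f t - f s) \<le> \<epsilon> *\<^sub>R u)"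

text \<open>The part of the \<open>n\<close>-th cell \<open>[n h, (n + 1) h]\<close> that lies to the left of \<open>s\<close>.\<close>

definition euler_weight :: "real \<Rightarrow> real \<Rightarrow> nat \<Rightarrow> real" where
  "euler_weight h s n = max 0 (min h (s - real n * h))"

text \<open>The integral over \<open>[0, s]\<close> of the step function that has the value \<open>f (n h)\<close> on the \<open>n\<close>-th cell; as
  a function of \<open>s\<close> it is an Euler polygon for the equation \<open>F' = f\<close>.\<close>

definition euler_sum ::
    "real \<Rightarrow> (real \<Rightarrow> 'a::real_vector complexification) \<Rightarrow> real \<Rightarrow> 'a complexification" where
  "euler_sum h f s =
     (\<Sum>n<nat \<lceil>s / h\<rceil>. complex_of_real (euler_weight h s n) *\<^sub>C f (real n * h))"

lemma sum_euler_weight: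
  assumes "0 < h" "0 \<le> s"
  shows "(\<Sum>n<K. euler_weight h s n) = min s (real K * h)"
proof (induction K)
  case 0
  then show ?case using assms by simp
next
  case (Suc K)
  have "min s x + max 0 (min h (s - x)) = min s (h + x)" for x using assms by auto
  then show ?case using Suc by (simp add: euler_weight_def algebra_simps)
qed

lemma euler_sum_eq:
  assumes "0 < h" "s \<le> real K * h"
  shows "euler_sum h f s = (\<Sum>n<K. complex_of_real (euler_weight h s n) *\<^sub>C f (real n * h))"
  unfolding euler_sum_def
proof (rule sum.mono_neutral_left)
  have "s / h \<le> real K" using assms by (simp add: field_simps)
  then have "nat \<lceil>s / h\<rceil> \<le> K" by (simp add: ceiling_le_iff)
  then show "{..<nat \<lceil>s / h\<rceil>} \<subseteq> {..<K}" by auto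
  show "\<forall>n\<in>{..<K} - {..<nat \<lceil>s / h\<rceil>}. complex_of_real (euler_weight h s n) *\<^sub>C f (real n * h) = 0"
  proof
    fix n assume "n \<in> {..<K} - {..<nat \<lceil>s / h\<rceil>}"
    then have "s / h \<le> real n" by simp
    then have "euler_weight h s n = 0" using assms by (simp add: field_simps euler_weight_def)
    then show "complex_of_real (euler_weight h s n) *\<^sub>C f (real n * h) = 0" by simp
  qed
qed simp

text \<open>The increment is an average of values of \<open>f\<close>, up to the factor \<open>b - a\<close>, and only cells
  that meet \<open>[a, b]\<close> have nonzero weight.\<close>

lemma euler_sum_increment:
  assumes h: "0 < h" and "0 \<le> a" "a \<le> t" "t \<le> b"
    and near: "\<And>s. 0 \<le> s \<Longrightarrow> \<bar>s - t\<bar> \<le> h + (b - a) \<Longrightarrow> modulus (f s - f t) \<le> m"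
  shows "modulus (euler_sum h f b - euler_sum h f a - complex_of_real (b - a) *\<^sub>C f t) \<le> (b - a) *\<^sub>R m"
proof -
  obtain K where "b / h \<le> real K" using real_arch_simple by blast
  then have K: "b \<le> real K * h" "a \<le> real K * h" using assms by (simp_all add: field_simps)
  define c where "c n = euler_weight h b n - euler_weight h a n" for n
  have c0: "0 \<le> c n" for n using assms by (auto simp: c_def euler_weight_def)
  have c: "\<bar>real n * h - t\<bar> \<le> h + (b - a)" if "c n \<noteq> 0" for n
  proof -
    have "\<bar>x - t\<bar> \<le> h + (b - a)"
      if "max 0 (min h (b - x)) - max 0 (min h (a - x)) \<noteq> 0" for x
      using that assms by (auto simp: max_def min_def split: if_splits)
    then show ?thesis using that by (simp add: c_def euler_weight_def)
  qed
  have csum: "(\<Sum>n<K. c n) = b - a"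
    using assms K by (simp add: c_def sum_subtractf sum_euler_weight)
  have "complex_of_real (b - a) *\<^sub>C f t = (\<Sum>n<K. complex_of_real (c n) *\<^sub>C f t)"
    unfolding csum[symmetric] of_real_sum by (rule complexification.scale_sum_left)
  then have "euler_sum h f b - euler_sum h f a - complex_of_real (b - a) *\<^sub>C f t
      = (\<Sum>n<K. complex_of_real (c n) *\<^sub>C (f (real n * h) - f t))"
    unfolding euler_sum_eq[OF h K(1)] euler_sum_eq[OF h K(2)]
    by (simp add: c_def complexification.scale_left_diff_distrib
        complexification.scale_right_diff_distrib flip: sum_subtractf)
  also have "modulus \<dots> \<le> (\<Sum>n<K. modulus (complex_of_real (c n) *\<^sub>C (f (real n * h) - f t)))"
    by (rule modulus_sum_le)
  also have "\<dots> \<le> (\<Sum>n<K. c n *\<^sub>R m)"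
  proof (rule sum_mono)
    fix n
    show "modulus (complex_of_real (c n) *\<^sub>C (f (real n * h) - f t)) \<le> c n *\<^sub>R m"
    proof (cases "c n = 0")
      case False
      then show ?thesis using c[OF False] c0[of n] h by (intro modulus_scaleC_mono near) auto
    qed simp
  qed
  also have "\<dots> = (b - a) *\<^sub>R m" by (simp add: csum flip: scaleR_sum_left)
  finally show ?thesis .
qed

text \<open>Two fine Euler polygons have almost the same increments over short intervals, so by the mean
  value inequality they form an ru-Cauchy sequence at every \<open>s\<close>. The bound on their increments is
  closed under ru-limits and hence passes to the limit \<open>F\<close>, with the original regulator.\<close>

lemma ru_primitive_exists:
  assumes "ru_uniformly_continuous f"
  shows "\<exists>F. ru_primitive F f \<and> F 0 = 0"
proof -
  obtain u where u: "0 \<le> u" and unif: "\<And>\<epsilon>. \<epsilon> > 0 \<Longrightarrow> \<exists>\<delta>>0. \<forall>s t. 0 \<le> s \<longrightarrow> s \<le> t \<longrightarrow> t - s \<le> \<delta> \<longrightarrow>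
      modulus (f t - f s) \<le> \<epsilon> *\<^sub>R u"
    using assms unfolding ru_uniformly_continuous_def by blast
  define P where "P N = euler_sum (1 / real (Suc N)) f" for N :: nat
  have P0: "P N 0 = 0" for N by (simp add: P_def euler_sum_def)
  have euler: "\<exists>\<delta>>0. \<exists>N0. \<forall>N\<ge>N0. \<forall>a t b. 0 \<le> a \<longrightarrow> a \<le> t \<longrightarrow> t \<le> b \<longrightarrow> b - a \<le> \<delta> \<longrightarrow>
      modulus (P N b - P N a - complex_of_real (b - a) *\<^sub>C f t) \<le> (\<epsilon> * (b - a)) *\<^sub>R u"
    if "\<epsilon> > 0" for \<epsilon>
  proof -
    \<comment> \<open>A point of a cell meeting \<open>[a, b]\<close> has distance at most \<open>h + (b - a)\<close> from \<open>t\<close>, so half of the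
      modulus of continuity goes to the step width \<open>h\<close> and half to \<open>b - a\<close>.\<close>
    obtain \<delta> where "\<delta> > 0" and d: "\<And>s t. 0 \<le> s \<Longrightarrow> s \<le> t \<Longrightarrow> t - s \<le> \<delta> \<Longrightarrow> modulus (f t - f s) \<le> \<epsilon> *\<^sub>R u"
      using unif[OF \<open>\<epsilon> > 0\<close>] by blast
    have d': "modulus (f s - f t) \<le> \<epsilon> *\<^sub>R u" if "0 \<le> s" "0 \<le> t" "\<bar>s - t\<bar> \<le> \<delta>" for s t
      using that d[of s t] d[of t s] by (cases "s \<le> t") (auto simp: modulus_minus_commute)
    obtain N0 where N0: "1 / real (Suc N0) < \<delta> / 2"
      using nat_approx_posE[of "\<delta> / 2"] \<open>\<delta> > 0\<close> by auto
    show ?thesis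
    proof (intro exI[of _ "\<delta> / 2"] conjI exI[of _ N0] allI impI)
      fix N a t b assume N: "N0 \<le> N" and ab: "0 \<le> a" "a \<le> t" "t \<le> b" "b - a \<le> \<delta> / 2"
      have "1 / real (Suc N) \<le> 1 / real (Suc N0)" using N by (intro divide_left_mono) auto
      with N0 have "1 / real (Suc N) \<le> \<delta> / 2" by linarith
      then have "modulus (P N b - P N a - complex_of_real (b - a) *\<^sub>C f t) \<le> (b - a) *\<^sub>R \<epsilon> *\<^sub>R u"
        unfolding P_def using ab by (intro euler_sum_increment d') auto
      then show "modulus (P N b - P N a - complex_of_real (b - a) *\<^sub>C f t) \<le> (\<epsilon> * (b - a)) *\<^sub>R u"
        by (simp add: mult.commute)
    qed (use \<open>\<delta> > 0\<close> in simp)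
  qed
  have cauchy: "\<exists>z. ru_tendsto (\<lambda>N. P N s) z sequentially" if s: "0 \<le> s" for s
  proof (rule complexification_ru_complete, intro exI[of _ "(2 * s) *\<^sub>R u"] conjI allI impI)
    show "0 \<le> (2 * s) *\<^sub>R u" using u s by (simp add: scaleR_nonneg_nonneg)
    fix \<epsilon> :: real assume "\<epsilon> > 0"
    from euler[OF this] obtain \<delta> N0 where "\<delta> > 0" and d: "\<And>N a t b. N \<ge> N0 \<Longrightarrow> 0 \<le> a \<Longrightarrow> a \<le> t \<Longrightarrow> t \<le> b \<Longrightarrow> b - a \<le> \<delta> \<Longrightarrow>
      modulus (P N b - P N a - complex_of_real (b - a) *\<^sub>C f t) \<le> (\<epsilon> * (b - a)) *\<^sub>R u"
      by blast
    have "modulus (P n s - P m s) \<le> \<epsilon> *\<^sub>R (2 * s) *\<^sub>R u" if nm: "n \<ge> N0" "m \<ge> N0" for n m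
    proof -
      have "modulus ((P n s - P m s) - (P n 0 - P m 0)) \<le> (2 * \<epsilon> * s) *\<^sub>R u - (2 * \<epsilon> * 0) *\<^sub>R u"
      proof (rule increments_le[OF \<open>\<delta> > 0\<close>])
        fix a b :: real assume ab: "0 \<le> a" "a \<le> b" "b - a \<le> \<delta>"
        from modulus_diff_mono[OF d[OF nm(1) ab(1) order_refl ab(2,3)] d[OF nm(2) ab(1) order_refl ab(2,3)]]
        show "modulus (P n b - P m b - (P n a - P m a)) \<le> (2 * \<epsilon> * b) *\<^sub>R u - (2 * \<epsilon> * a) *\<^sub>R u"
          by (simp add: algebra_simps flip: scaleR_left_distrib)
      qed (use s in auto)
      then show ?thesis by (simp add: P0 algebra_simps)
    qed
    then show "\<exists>N. \<forall>n\<ge>N. \<forall>m\<ge>N. modulus (P n s - P m s) \<le> \<epsilon> *\<^sub>R (2 * s) *\<^sub>R u" by blast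
  qed
  define F where "F s = ru_Lim sequentially (\<lambda>N. P N s)" for s
  have F: "ru_tendsto (\<lambda>N. P N s) (F s) sequentially" if "0 \<le> s" for s
    using cauchy[OF that] ru_LimI[OF _ sequentially_bot] unfolding F_def by metis
  have "ru_primitive F f"
    unfolding ru_primitive_def
  proof (intro exI[of _ u] conjI u allI impI)
    fix \<epsilon> :: real assume "\<epsilon> > 0"
    from euler[OF this] obtain \<delta> N0 where "\<delta> > 0" and d: "\<And>N a t b. N \<ge> N0 \<Longrightarrow> 0 \<le> a \<Longrightarrow> a \<le> t \<Longrightarrow> t \<le> b \<Longrightarrow> b - a \<le> \<delta> \<Longrightarrow>
      modulus (P N b - P N a - complex_of_real (b - a) *\<^sub>C f t) \<le> (\<epsilon> * (b - a)) *\<^sub>R u"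
      by blast
    show "\<exists>\<delta>>0. \<forall>a t b. 0 \<le> a \<longrightarrow> a \<le> t \<longrightarrow> t \<le> b \<longrightarrow> b - a \<le> \<delta> \<longrightarrow>
       modulus (F b - F a - complex_of_real (b - a) *\<^sub>C f t) \<le> (\<epsilon> * (b - a)) *\<^sub>R u"
    proof (intro exI[of _ \<delta>] conjI allI impI)
      fix a t b assume ab: "0 \<le> a" "a \<le> t" "t \<le> b" "b - a \<le> \<delta>"
      then have "ru_tendsto (\<lambda>N. P N b - P N a - complex_of_real (b - a) *\<^sub>C f t)
          (F b - F a - complex_of_real (b - a) *\<^sub>C f t) sequentially"
        by (intro ru_tendsto_diff F ru_tendsto_const) auto
      then show "modulus (F b - F a - complex_of_real (b - a) *\<^sub>C f t) \<le> (\<epsilon> * (b - a)) *\<^sub>R u"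
        by (rule ru_tendsto_modulus_le) (use ab in \<open>auto intro!: eventually_sequentiallyI[of N0] d simp del: of_real_diff\<close>)
    qed fact
  qed
  moreover have "F 0 = 0" by (simp add: F_def P0 ru_LimI)
  ultimately show ?thesis by blast
qed

lemma sum_increments: "(\<Sum>i=1..n. F i - F (i - 1)) = F n - F 0"
  for F :: "nat \<Rightarrow> 'b::ab_group_add"
  by (induction n) auto

text \<open>Write \<open>F s - F 0\<close> as the sum of the increments over the cells of the partition; each differs from
  the corresponding term of the Riemann sum by at most \<open>\<epsilon>\<close> times the length of its cell.\<close>

lemma ru_primitive_has_integral:
  assumes "ru_primitive F f" "0 \<le> s"
  shows "has_ru_integral f (F s - F 0) s"
proof -
  obtain u where u: "0 \<le> u" and p: "\<And>\<epsilon>. \<epsilon> > 0 \<Longrightarrow> \<exists>\<delta>>0. \<forall>a t b. 0 \<le> a \<longrightarrow> a \<le> t \<longrightarrow> t \<le> b \<longrightarrow> b - a \<le> \<delta> \<longrightarrow>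
     modulus (F b - F a - complex_of_real (b - a) *\<^sub>C f t) \<le> (\<epsilon> * (b - a)) *\<^sub>R u"
    using assms(1) by (rule ru_primitiveE) blast
  show ?thesis
    unfolding has_ru_integral_def
  proof (intro exI[of _ "s *\<^sub>R u"] conjI allI impI)
    show "0 \<le> s *\<^sub>R u" using assms u by (simp add: scaleR_nonneg_nonneg)
    fix \<epsilon> :: real assume "\<epsilon> > 0"
    then obtain \<delta> where "\<delta> > 0" and d: "\<And>a t b. 0 \<le> a \<Longrightarrow> a \<le> t \<Longrightarrow> t \<le> b \<Longrightarrow> b - a \<le> \<delta> \<Longrightarrow>
     modulus (F b - F a - complex_of_real (b - a) *\<^sub>C f t) \<le> (\<epsilon> * (b - a)) *\<^sub>R u"
      using p by blast
    show "\<exists>\<delta>>0. \<forall>n p t. is_partition n p s \<longrightarrow> (\<forall>i\<in>{1..n}. \<bar>p i - p (i - 1)\<bar> \<le> \<delta>) \<longrightarrow>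
        (\<forall>i\<in>{1..n}. t i \<in> {p (i - 1)..p i}) \<longrightarrow>
        modulus ((\<Sum>i=1..n. complex_of_real (p i - p (i - 1)) *\<^sub>C f (t i)) - (F s - F 0)) \<le> \<epsilon> *\<^sub>R s *\<^sub>R u"
    proof (intro exI[of _ \<delta>] conjI \<open>\<delta> > 0\<close> allI impI)
      fix n p t
      assume part: "is_partition n p s" and mesh: "\<forall>i\<in>{1..n}. \<bar>p i - p (i - 1)\<bar> \<le> \<delta>"
        and tags: "\<forall>i\<in>{1..n}. t i \<in> {p (i - 1)..p i}"
      have p0: "p 0 = 0" "p n = s" and inc: "\<And>i. i \<in> {1..n} \<Longrightarrow> p (i - 1) < p i"
        using part by (auto simp: is_partition_def)
      have nonneg: "i \<le> n \<Longrightarrow> 0 \<le> p i" for i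
      proof (induction i)
        case (Suc i)
        then show ?case using inc[of "Suc i"] by simp
      qed (simp add: p0)
      have "F s - F 0 = (\<Sum>i=1..n. F (p i) - F (p (i - 1)))"
        using sum_increments[of "\<lambda>i. F (p i)" n] p0 by simp
      then have "modulus ((\<Sum>i=1..n. complex_of_real (p i - p (i - 1)) *\<^sub>C f (t i)) - (F s - F 0))
        = modulus (\<Sum>i=1..n. F (p i) - F (p (i - 1)) - complex_of_real (p i - p (i - 1)) *\<^sub>C f (t i))"
        by (simp add: sum_subtractf modulus_minus_commute)
      also have "\<dots> \<le> (\<Sum>i=1..n. modulus (F (p i) - F (p (i - 1)) - complex_of_real (p i - p (i - 1)) *\<^sub>C f (t i)))"
        by (rule modulus_sum_le)
      also have "\<dots> \<le> (\<Sum>i=1..n. (\<epsilon> * (p i - p (i - 1))) *\<^sub>R u)"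
      proof (rule sum_mono)
        fix i assume i: "i \<in> {1..n}"
        then have "0 \<le> p (i - 1)" by (intro nonneg) auto
        moreover have "\<bar>p i - p (i - 1)\<bar> \<le> \<delta>" "t i \<in> {p (i - 1)..p i}"
          using mesh tags i by blast+
        ultimately show "modulus (F (p i) - F (p (i - 1)) - complex_of_real (p i - p (i - 1)) *\<^sub>C f (t i))
            \<le> (\<epsilon> * (p i - p (i - 1))) *\<^sub>R u"
          using inc[OF i] by (intro d) auto
      qed
      also have "\<dots> = (\<epsilon> * (\<Sum>i=1..n. p i - p (i - 1))) *\<^sub>R u"
        by (simp only: scaleR_sum_left sum_distrib_left)
      also have "\<dots> = \<epsilon> *\<^sub>R s *\<^sub>R u" using sum_increments[of p n] p0 by simp
      finally show "modulus ((\<Sum>i=1..n. complex_of_real (p i - p (i - 1)) *\<^sub>C f (t i)) - (F s - F 0)) \<le> \<epsilon> *\<^sub>R s *\<^sub>R u" .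
    qed
  qed
qed

text \<open>Equidistant partitions witness that integrals are unique and that they inherit closed properties
  of the integrand.\<close>

lemma riemann_sums_ru_tendsto:
  assumes "has_ru_integral f I s" "0 \<le> s"
  shows "ru_tendsto (\<lambda>N. \<Sum>i=1..Suc N. complex_of_real (s / real (Suc N)) *\<^sub>C f (s * real i / real (Suc N)))
    I sequentially"
proof -
  obtain u where u: "0 \<le> u" and int: "\<And>\<epsilon>. \<epsilon> > 0 \<Longrightarrow> \<exists>\<delta>>0. \<forall>n p t.
        is_partition n p s \<longrightarrow> (\<forall>i\<in>{1..n}. \<bar>p i - p (i - 1)\<bar> \<le> \<delta>) \<longrightarrow>
        (\<forall>i\<in>{1..n}. t i \<in> {p (i - 1)..p i}) \<longrightarrow>
        modulus ((\<Sum>i=1..n. complex_of_real (p i - p (i - 1)) *\<^sub>C f (t i)) - I) \<le> \<epsilon> *\<^sub>R u"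
    using assms(1) unfolding has_ru_integral_def by blast
  show ?thesis
  proof (cases "s = 0")
    case True
    have "modulus I \<le> 0 + \<epsilon> *\<^sub>R u" if e: "\<epsilon> > 0" for \<epsilon>
    proof -
      have "is_partition 0 (\<lambda>_. 0) s" using True by (simp add: is_partition_def)
      then have "modulus ((\<Sum>i=1..0. complex_of_real (0 - 0) *\<^sub>C f 0) - I) \<le> \<epsilon> *\<^sub>R u"
        using int[OF e] by fastforce
      then show ?thesis by simp
    qed
    then have "I = 0" using modulus_le_if_approx[OF u] modulus_le_0D by blast
    with True show ?thesis by simp
  next
    case False
    with \<open>0 \<le> s\<close> have s: "0 < s" by simp
    show ?thesis
    proof (rule ru_tendstoI[OF u])
      fix \<epsilon> :: real assume "\<epsilon> > 0"
      then obtain \<delta> where "\<delta> > 0" and d: "\<And>n p t. is_partition n p s \<Longrightarrow> (\<forall>i\<in>{1..n}. \<bar>p i - p (i - 1)\<bar> \<le> \<delta>) \<Longrightarrow>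
        (\<forall>i\<in>{1..n}. t i \<in> {p (i - 1)..p i}) \<Longrightarrow>
        modulus ((\<Sum>i=1..n. complex_of_real (p i - p (i - 1)) *\<^sub>C f (t i)) - I) \<le> \<epsilon> *\<^sub>R u"
        using int by blast
      have "(\<lambda>N. s / real (Suc N)) \<longlonglongrightarrow> 0"
        by (intro real_tendsto_divide_at_top[OF tendsto_const] filterlim_compose[OF filterlim_real_sequentially filterlim_Suc])
      then have "\<forall>\<^sub>F N in sequentially. s / real (Suc N) < \<delta>"
        using \<open>\<delta> > 0\<close> by (rule order_tendstoD)
      then show "\<forall>\<^sub>F N in sequentially. modulus ((\<Sum>i=1..Suc N. complex_of_real (s / real (Suc N)) *\<^sub>C f (s * real i / real (Suc N))) - I) \<le> \<epsilon> *\<^sub>R u"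
      proof eventually_elim
        case (elim N)
        define p where "p i = s * real i / real (Suc N)" for i
        have diff: "p i - p (i - 1) = s / real (Suc N)" if "i \<in> {1..Suc N}" for i
        proof -
          have "s * real i - s * real (i - 1) = s"
            using that by (cases i) (simp_all add: algebra_simps)
          then show ?thesis by (simp only: p_def flip: diff_divide_distrib)
        qed
        then have lt: "p (i - 1) < p i" if "i \<in> {1..Suc N}" for i
          using that s diff[OF that] by (smt (verit) divide_pos_pos of_nat_0_less_iff zero_less_Suc)
        have "modulus ((\<Sum>i=1..Suc N. complex_of_real (p i - p (i - 1)) *\<^sub>C f (p i)) - I) \<le> \<epsilon> *\<^sub>R u"
        proof (rule d)
          show "is_partition (Suc N) p s" unfolding is_partition_def
            using lt by (auto simp: p_def)
          show "\<forall>i\<in>{1..Suc N}. \<bar>p i - p (i - 1)\<bar> \<le> \<delta>"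
            using diff elim s by (auto simp del: of_nat_Suc)
          show "\<forall>i\<in>{1..Suc N}. p i \<in> {p (i - 1)..p i}"
            using lt by (simp add: less_imp_le)
        qed
        also have "(\<Sum>i=1..Suc N. complex_of_real (p i - p (i - 1)) *\<^sub>C f (p i))
          = (\<Sum>i=1..Suc N. complex_of_real (s / real (Suc N)) *\<^sub>C f (s * real i / real (Suc N)))"
          by (rule sum.cong[OF refl]) (simp only: diff, simp only: p_def)
        finally show ?case .
      qed
    qed
  qed
qed

lemma ru_integral_eq:
  assumes "has_ru_integral f I s" "0 \<le> s"
  shows "ru_integral f s = I"
  unfolding ru_integral_def
  using assms riemann_sums_ru_tendsto ru_tendsto_unique sequentially_bot by (metis (mono_tags, lifting) the_equality)

lemma ru_primitive_ru_integral:
  "ru_primitive F f \<Longrightarrow> 0 \<le> s \<Longrightarrow> ru_integral f s = F s - F 0"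
  by (intro ru_integral_eq ru_primitive_has_integral)

lemma ru_primitive_unique:
  "ru_primitive F f \<Longrightarrow> ru_primitive G f \<Longrightarrow> 0 \<le> s \<Longrightarrow> F s - F 0 = G s - G 0"
  using ru_primitive_ru_integral by metis

lemma positive_cone_iff: "z \<in> positive_cone \<longleftrightarrow> 0 \<le> re z \<and> im z = 0"
  by (cases z) (auto simp: positive_cone_def)

lemma positive_cone_closed:
  assumes "ru_tendsto f l F" "F \<noteq> bot" "\<forall>\<^sub>F a in F. f a \<in> positive_cone"
  shows "l \<in> positive_cone"
proof -
  obtain u where u: "0 \<le> u" "\<And>\<epsilon>. \<epsilon> > 0 \<Longrightarrow> \<forall>\<^sub>F a in F. modulus (f a - l) \<le> \<epsilon> *\<^sub>R u"
    using assms(1) by (rule ru_tendstoE) blast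
  have "- re l \<le> 0 + \<epsilon> *\<^sub>R u \<and> \<bar>im l\<bar> \<le> 0 + \<epsilon> *\<^sub>R u" if e: "\<epsilon> > 0" for \<epsilon>
  proof -
    obtain a where a: "modulus (f a - l) \<le> \<epsilon> *\<^sub>R u" "f a \<in> positive_cone"
      using eventually_happens'[OF assms(2) eventually_conj[OF u(2)[OF e] assms(3)]] by blast
    have "re (f a) - re l \<le> \<epsilon> *\<^sub>R u"
      using order_trans[OF abs_ge_self order_trans[OF abs_re_le_modulus a(1)]] by simp
    moreover have "- re l \<le> re (f a) - re l" using a(2) by (simp add: positive_cone_iff)
    moreover have "\<bar>im l\<bar> \<le> \<epsilon> *\<^sub>R u"
      using order_trans[OF abs_im_le_modulus a(1)] a(2) by (simp add: positive_cone_iff)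
    ultimately show ?thesis by (metis add_0 order_trans)
  qed
  then have "- re l \<le> 0" "\<bar>im l\<bar> \<le> 0" using archimedean_le[OF u(1)] by blast+
  then show ?thesis by (simp add: positive_cone_iff)
qed

lemma positive_cone_sum:
  assumes "\<And>i. i \<in> A \<Longrightarrow> 0 \<le> c i" "\<And>i. i \<in> A \<Longrightarrow> f i \<in> positive_cone"
  shows "(\<Sum>i\<in>A. complex_of_real (c i) *\<^sub>C f i) \<in> positive_cone"
  using assms
proof (induction A rule: infinite_finite_induct)
  case (insert i A)
  then show ?case by (simp add: positive_cone_iff scaleR_nonneg_nonneg)
qed (auto simp: positive_cone_iff)

lemma has_ru_integral_positive:
  assumes "has_ru_integral f I s" "0 \<le> s" "\<And>t. 0 \<le> t \<Longrightarrow> f t \<in> positive_cone"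
  shows "I \<in> positive_cone"
  using riemann_sums_ru_tendsto[OF assms(1,2)] sequentially_bot
proof (rule positive_cone_closed)
  show "\<forall>\<^sub>F N in sequentially. (\<Sum>i=1..Suc N. complex_of_real (s / real (Suc N)) *\<^sub>C f (s * real i / real (Suc N))) \<in> positive_cone"
    using assms(2,3) by (intro always_eventually allI positive_cone_sum) auto
qed

text \<open>The majorant \<open>g\<close> is an integral of the bound \<open>exp (- c t) u\<close>, enlarged by \<open>\<epsilon> t v\<close> to absorb the error of
  the derivative. On a short interval the bound on \<open>f\<close> is used at the right end, where it is smallest.\<close>

lemma ru_primitive_increment_exp_le:
  assumes prim: "ru_primitive F f" and c: "0 < c" and u: "0 \<le> u"
    and bound: "\<And>t. 0 \<le> t \<Longrightarrow> modulus (f t) \<le> exp (- c * t) *\<^sub>R u"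
    and ab: "0 \<le> a" "a \<le> b"
  shows "modulus (F b - F a) \<le> ((exp (- c * a) - exp (- c * b)) / c) *\<^sub>R u"
proof -
  obtain v where v: "0 \<le> v" and p: "\<And>\<epsilon>. \<epsilon> > 0 \<Longrightarrow> \<exists>\<delta>>0. \<forall>a t b. 0 \<le> a \<longrightarrow> a \<le> t \<longrightarrow> t \<le> b \<longrightarrow> b - a \<le> \<delta> \<longrightarrow>
     modulus (F b - F a - complex_of_real (b - a) *\<^sub>C f t) \<le> (\<epsilon> * (b - a)) *\<^sub>R v"
    using prim by (rule ru_primitiveE) blast
  show ?thesis
  proof (rule modulus_le_if_approx)
    show "0 \<le> (b - a) *\<^sub>R v" using ab v by (simp add: scaleR_nonneg_nonneg)
    fix \<epsilon> :: real assume "\<epsilon> > 0"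
    then obtain \<delta> where "\<delta> > 0" and d: "\<And>a t b. 0 \<le> a \<Longrightarrow> a \<le> t \<Longrightarrow> t \<le> b \<Longrightarrow> b - a \<le> \<delta> \<Longrightarrow>
     modulus (F b - F a - complex_of_real (b - a) *\<^sub>C f t) \<le> (\<epsilon> * (b - a)) *\<^sub>R v"
      using p by blast
    define g where "g t = (- exp (- c * t) / c) *\<^sub>R u + (\<epsilon> * t) *\<^sub>R v" for t
    have gdiff: "g b - g a = ((exp (- c * a) - exp (- c * b)) / c) *\<^sub>R u + (\<epsilon> * (b - a)) *\<^sub>R v" for a b
      by (simp add: g_def algebra_simps diff_divide_distrib)
    have "modulus (F b - F a) \<le> g b - g a"
    proof (rule increments_le[OF \<open>\<delta> > 0\<close> _ ab])
      fix a b :: real assume ab: "0 \<le> a" "a \<le> b" "b - a \<le> \<delta>"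
      \<comment> \<open>Convexity of the exponential: \<open>(b - a) exp (- c b)\<close> is at most the integral of \<open>exp (- c t)\<close>.\<close>
      have "modulus (complex_of_real (b - a) *\<^sub>C f b) \<le> (b - a) *\<^sub>R exp (- c * b) *\<^sub>R u"
        using ab by (intro modulus_scaleC_mono bound) (auto simp del: of_real_diff)
      from modulus_add_mono[OF this d[of a b b]] ab
      have "modulus (F b - F a) \<le> ((b - a) * exp (- c * b)) *\<^sub>R u + (\<epsilon> * (b - a)) *\<^sub>R v"
        by simp
      also have "\<dots> \<le> g b - g a"
      proof -
        have "exp (- c * b) * (1 + c * (b - a)) \<le> exp (- c * b) * exp (c * (b - a))"
          by (intro mult_left_mono exp_ge_add_one_self) simp
        also have "\<dots> = exp (- c * a)" by (simp add: algebra_simps flip: exp_add)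
        finally have "(b - a) * exp (- c * b) \<le> (exp (- c * a) - exp (- c * b)) / c"
          using c by (simp add: field_simps)
        then show ?thesis unfolding gdiff using u by (intro add_right_mono scaleR_right_mono)
      qed
      finally show "modulus (F b - F a) \<le> g b - g a" .
    qed
    then show "modulus (F b - F a) \<le> ((exp (- c * a) - exp (- c * b)) / c) *\<^sub>R u + \<epsilon> *\<^sub>R (b - a) *\<^sub>R v"
      unfolding gdiff by simp
  qed
qed

lemma ru_primitive_limit:
  assumes prim: "ru_primitive F f" and c: "0 < c" and u: "0 \<le> u"
    and bound: "\<And>t. 0 \<le> t \<Longrightarrow> modulus (f t) \<le> exp (- c * t) *\<^sub>R u"
  shows "\<exists>J. ru_tendsto F J at_top \<and> modulus (J - F 0) \<le> (1 / c) *\<^sub>R u"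
proof -
  have tail: "modulus (F t - F s) \<le> (exp (- c * r) / c) *\<^sub>R u" if "0 \<le> r" "r \<le> s" "r \<le> t" for r s t
  proof -
    have *: "modulus (F t - F s) \<le> (exp (- c * r) / c) *\<^sub>R u" if "r \<le> s" "s \<le> t" for s t
    proof -
      have "modulus (F t - F s) \<le> ((exp (- c * s) - exp (- c * t)) / c) *\<^sub>R u"
        using that \<open>0 \<le> r\<close> by (intro ru_primitive_increment_exp_le[OF prim c u bound]) auto
      also have "\<dots> \<le> (exp (- c * r) / c) *\<^sub>R u"
      proof (intro scaleR_right_mono u divide_right_mono)
        have "exp (- c * s) \<le> exp (- c * r)" using c that by simp
        then show "exp (- c * s) - exp (- c * t) \<le> exp (- c * r)"
          using exp_ge_zero[of "- c * t"] by linarith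
      qed (use c in simp)
      finally show ?thesis .
    qed
    show ?thesis using *[of s t] *[of t s] that by (cases "s \<le> t") (auto simp: modulus_minus_commute)
  qed
  have "((\<lambda>r. exp (- c * r) / c) \<longlongrightarrow> 0 / c) at_top"
    using c by (intro tendsto_divide tendsto_const filterlim_compose[OF exp_at_bot]
        filterlim_tendsto_neg_mult_at_bot[OF tendsto_const _ filterlim_ident]) auto
  then have small: "\<forall>\<^sub>F r in at_top. exp (- c * r) / c < \<epsilon>" if "\<epsilon> > 0" for \<epsilon>
    using that by (intro order_tendstoD(2)) auto
  have "\<exists>J. ru_tendsto (\<lambda>n. F (real n)) J sequentially"
  proof (rule complexification_ru_complete, intro exI[of _ u] conjI u allI impI)
    fix \<epsilon> :: real assume "\<epsilon> > 0"
    have "\<forall>\<^sub>F n in sequentially. exp (- c * real n) / c < \<epsilon>"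
      using small[OF \<open>\<epsilon> > 0\<close>] filterlim_real_sequentially by (auto simp: filterlim_iff)
    then obtain N where N: "exp (- c * real N) / c < \<epsilon>" by (auto simp: eventually_sequentially)
    have "modulus (F (real n) - F (real m)) \<le> \<epsilon> *\<^sub>R u" if "n \<ge> N" "m \<ge> N" for n m
    proof -
      have "modulus (F (real n) - F (real m)) \<le> (exp (- c * real N) / c) *\<^sub>R u"
        using that by (intro tail) auto
      also have "\<dots> \<le> \<epsilon> *\<^sub>R u" using N u by (intro scaleR_right_mono) auto
      finally show ?thesis .
    qed
    then show "\<exists>N. \<forall>n\<ge>N. \<forall>m\<ge>N. modulus (F (real n) - F (real m)) \<le> \<epsilon> *\<^sub>R u" by blast
  qed
  then obtain J where J: "ru_tendsto (\<lambda>n. F (real n)) J sequentially" by blast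
  have Jtail: "modulus (J - F s) \<le> (exp (- c * s) / c) *\<^sub>R u" if "0 \<le> s" for s
  proof (rule ru_tendsto_modulus_le[OF ru_tendsto_diff[OF J ru_tendsto_const] sequentially_bot])
    show "\<forall>\<^sub>F n in sequentially. modulus (F (real n) - F s) \<le> (exp (- c * s) / c) *\<^sub>R u"
      using eventually_ge_at_top[of "nat \<lceil>s\<rceil>"]
    proof eventually_elim
      case (elim n)
      then have "s \<le> real n" by linarith
      then show ?case using tail[of s s "real n"] that by simp
    qed
  qed
  have "ru_tendsto F J at_top"
  proof (rule ru_tendstoI[OF u])
    fix \<epsilon> :: real assume "\<epsilon> > 0"
    from small[OF this] eventually_ge_at_top[of 0]
    show "\<forall>\<^sub>F s in at_top. modulus (F s - J) \<le> \<epsilon> *\<^sub>R u"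
    proof eventually_elim
      case (elim s)
      have "modulus (F s - J) \<le> (exp (- c * s) / c) *\<^sub>R u"
        using Jtail[OF elim(2)] by (simp add: modulus_minus_commute)
      also have "\<dots> \<le> \<epsilon> *\<^sub>R u" using elim u by (intro scaleR_right_mono) auto
      finally show ?case .
    qed
  qed
  with Jtail[of 0] show ?thesis by auto
qed

text \<open>This reduces every statement on improper integrals to one on limits of primitives.\<close>

lemma improper_ru_integral_primitive:
  assumes "ru_primitive F f" "F 0 = 0" "ru_tendsto F J at_top"
  shows "improper_ru_integrable f" "improper_ru_integral f = J"
proof -
  have "\<forall>\<^sub>F s in at_top. ru_integral f s = F s"
    using eventually_ge_at_top[of 0]
    by eventually_elim (simp add: ru_primitive_ru_integral[OF assms(1)] assms(2))
  then have lim: "ru_tendsto (ru_integral f) J at_top"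
    by (rule ru_tendsto_cong[OF assms(3)])
  then show "improper_ru_integrable f"
    unfolding improper_ru_integrable_def ru_integrable_def
    using ru_primitive_has_integral[OF assms(1)] by blast
  show "improper_ru_integral f = J"
    unfolding improper_ru_integral_def using lim by (rule ru_LimI) simp
qed

lemma exp_difference_quotient:
  "((\<lambda>h. (exp (l * complex_of_real h) - 1) / complex_of_real h) \<longlongrightarrow> l) (at_right 0)"
proof -
  have "((\<lambda>z. exp (l * z)) has_field_derivative l) (at 0)"
    by (auto intro!: derivative_eq_intros)
  then have "((\<lambda>z. (exp (l * z) - 1) / z) \<longlongrightarrow> l) (at 0)"
    by (simp add: has_field_derivative_iff)
  moreover have "filterlim complex_of_real (at 0) (at_right 0)"
    unfolding filterlim_at
  proof
    show "(complex_of_real \<longlongrightarrow> 0) (at_right 0)"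
      using tendsto_of_real[OF tendsto_ident_at, of 0 "{0<..}"] by simp
    show "\<forall>\<^sub>F h in at_right 0. complex_of_real h \<in> UNIV \<and> complex_of_real h \<noteq> 0"
      using eventually_at_right_less[of 0] by (auto elim!: eventually_mono)
  qed
  ultimately show ?thesis by (rule filterlim_compose)
qed

lemma generator_eqI:
  "ru_tendsto (difference_quotient T x) y (at_right 0) \<Longrightarrow> generator T x = y"
  unfolding generator_def by (rule ru_LimI) simp_all

section \<open>The Laplace transform of a semigroup\<close>

locale exp_bounded_positive_semigroup =
  fixes T :: "real \<Rightarrow> 'a::ru_complete_vector_lattice complexification \<Rightarrow> 'a complexification"
    and w :: real
  assumes ru_continuous_semigroup: "ru_continuous_semigroup T"
    and positive_semigroup: "positive_semigroup T"
    and exponentially_order_bounded: "exponentially_order_bounded T w"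
begin

lemma T_zero [simp]: "T 0 x = x"
  using ru_continuous_semigroup by (simp add: ru_continuous_semigroup_def)

lemma T_add: "0 \<le> s \<Longrightarrow> 0 \<le> t \<Longrightarrow> T (t + s) x = T t (T s x)"
  using ru_continuous_semigroup by (simp add: ru_continuous_semigroup_def)

lemma T_positive: "0 \<le> t \<Longrightarrow> positive_operator (T t)"
  using positive_semigroup by (simp add: positive_semigroup_def)

lemma T_order_bounded: "0 \<le> t \<Longrightarrow> order_bounded (T t)"
  by (intro positive_operator_order_bounded T_positive)

lemma T_linear: "0 \<le> t \<Longrightarrow> Vector_Spaces.linear scaleC scaleC (T t)"
  using T_positive by (simp add: positive_operator_def)

lemmas T_linear_ops = linear_ops[OF T_linear]

lemma orbit_bound:
  obtains v where "0 \<le> v" "\<And>t. 0 \<le> t \<Longrightarrow> modulus (T t x) \<le> exp (w * t) *\<^sub>R v"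
  using exponentially_order_bounded unfolding exponentially_order_bounded_def by blast

text \<open>Positivity gives \<open>\<bar>T t z\<bar> \<le> T t \<bar>z\<bar>\<close>; hence the orbit of \<open>u\<close> bounds all orbits that start in the order
  interval of \<open>u\<close>, with one \<open>v\<close>.\<close>

lemma orbit_bound_uniform:
  assumes u: "0 \<le> u"
  obtains v where "0 \<le> v"
    "\<And>t \<epsilon> z. 0 \<le> t \<Longrightarrow> 0 \<le> \<epsilon> \<Longrightarrow> modulus z \<le> \<epsilon> *\<^sub>R u \<Longrightarrow> modulus (T t z) \<le> exp (w * t) *\<^sub>R \<epsilon> *\<^sub>R v"
proof -
  obtain v where v: "0 \<le> v" "\<And>t. 0 \<le> t \<Longrightarrow> modulus (T t (Cplx u 0)) \<le> exp (w * t) *\<^sub>R v"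
    using orbit_bound by blast
  have "modulus (T t z) \<le> exp (w * t) *\<^sub>R \<epsilon> *\<^sub>R v"
    if "0 \<le> t" "0 \<le> \<epsilon>" "modulus z \<le> \<epsilon> *\<^sub>R u" for t \<epsilon> z
  proof -
    have "Cplx (\<epsilon> *\<^sub>R u) 0 = complex_of_real \<epsilon> *\<^sub>C Cplx u 0"
      by (simp add: complexification.expand)
    then have "re (T t (Cplx (\<epsilon> *\<^sub>R u) 0)) = \<epsilon> *\<^sub>R re (T t (Cplx u 0))"
      using T_linear_ops(3)[OF that(1)] by simp
    also have "\<dots> \<le> \<epsilon> *\<^sub>R exp (w * t) *\<^sub>R v"
      using that v by (intro scaleR_left_mono order_trans[OF abs_ge_self order_trans[OF abs_re_le_modulus]]) auto
    finally have "re (T t (Cplx (\<epsilon> *\<^sub>R u) 0)) \<le> exp (w * t) *\<^sub>R \<epsilon> *\<^sub>R v"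
      by (simp add: mult.commute)
    with positive_operator_modulus_le[OF T_positive[OF that(1)] that(3)] show ?thesis
      by (rule order_trans)
  qed
  with v show ?thesis using that by blast
qed

lemma laplace_integrand_zero [simp]: "laplace_integrand T l x 0 = x"
  by (simp add: laplace_integrand_def)

lemma laplace_integrand_le:
  assumes "modulus (T t x) \<le> exp (w * t) *\<^sub>R u"
  shows "modulus (laplace_integrand T l x t) \<le> exp (- (Re l - w) * t) *\<^sub>R u"
proof -
  have "modulus (laplace_integrand T l x t) \<le> exp (- Re l * t) *\<^sub>R exp (w * t) *\<^sub>R u"
    unfolding laplace_integrand_def using assms by (intro modulus_scaleC_mono) (simp_all add: norm_exp_eq_Re)
  also have "\<dots> = exp (- (Re l - w) * t) *\<^sub>R u" by (simp add: algebra_simps flip: exp_add)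
  finally show ?thesis .
qed

lemma laplace_integrand_add:
  assumes "0 \<le> h" "0 \<le> t"
  shows "laplace_integrand T l x (h + t) = exp (- l * complex_of_real h) *\<^sub>C T h (laplace_integrand T l x t)"
  using assms by (simp add: laplace_integrand_def T_add T_linear_ops algebra_simps flip: exp_add)

lemma laplace_integrand_diff:
  assumes "0 \<le> t"
  shows "laplace_integrand T l (x - y) t = laplace_integrand T l x t - laplace_integrand T l y t"
  using assms by (simp add: laplace_integrand_def T_linear_ops complexification.scale_right_diff_distrib)

lemma orbit_ru_tendsto: "ru_tendsto (\<lambda>h. T h x) x (at_right 0)"
proof -
  have "ru_continuous (\<lambda>t. T t x)"
    using ru_continuous_semigroup unfolding ru_continuous_semigroup_def by blast
  then obtain u :: "real \<Rightarrow> 'a" where "\<forall>t\<ge>0. u t \<ge> 0" and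
    *: "\<forall>\<epsilon>>0. \<exists>\<delta>>0. \<forall>t\<ge>0. \<forall>h\<in>{- min \<delta> t..\<delta>}. modulus (T (t + h) x - T t x) \<le> \<epsilon> *\<^sub>R u t"
    unfolding ru_continuous_def by (elim exE conjE)
  show ?thesis
  proof (rule ru_tendstoI[of "u 0"])
    show "0 \<le> u 0" using \<open>\<forall>t\<ge>0. u t \<ge> 0\<close> by simp
    fix \<epsilon> :: real assume "\<epsilon> > 0"
    then obtain \<delta> where "\<delta> > 0"
      and "\<forall>t\<ge>0. \<forall>h\<in>{- min \<delta> t..\<delta>}. modulus (T (t + h) x - T t x) \<le> \<epsilon> *\<^sub>R u t"
      using * by blast
    then have "\<forall>h\<in>{- min \<delta> 0..\<delta>}. modulus (T (0 + h) x - T 0 x) \<le> \<epsilon> *\<^sub>R u 0" by blast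
    with \<open>\<delta> > 0\<close> show "\<forall>\<^sub>F h in at_right 0. modulus (T h x - x) \<le> \<epsilon> *\<^sub>R u 0"
      unfolding eventually_at_right_field by (intro exI[of _ \<delta>]) auto
  qed
qed

text \<open>With \<open>f t = exp (- l t) T t x\<close> one has \<open>f (s + h) - f s = exp (- l s) T s (f h - x)\<close>. So continuity at
  \<open>0\<close> suffices, and the growth of \<open>T s\<close> is compensated by the exponential factor.\<close>

lemma laplace_integrand_uniformly_continuous:
  assumes l: "w < Re l"
  shows "ru_uniformly_continuous (laplace_integrand T l x)"
proof -
  have "((\<lambda>h. exp (- l * complex_of_real h)) \<longlongrightarrow> exp (- l * complex_of_real 0)) (at_right 0)"
    by (intro tendsto_intros)
  from ru_tendsto_scaleC[OF this orbit_ru_tendsto[of x]]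
  have "ru_tendsto (laplace_integrand T l x) x (at_right 0)"
    by (simp add: laplace_integrand_def[abs_def])
  then obtain u where u: "0 \<le> u"
    "\<And>\<epsilon>. \<epsilon> > 0 \<Longrightarrow> \<forall>\<^sub>F h in at_right 0. modulus (laplace_integrand T l x h - x) \<le> \<epsilon> *\<^sub>R u"
    by (rule ru_tendstoE) blast
  obtain v where v: "0 \<le> v"
    "\<And>t \<epsilon> z. 0 \<le> t \<Longrightarrow> 0 \<le> \<epsilon> \<Longrightarrow> modulus z \<le> \<epsilon> *\<^sub>R u \<Longrightarrow> modulus (T t z) \<le> exp (w * t) *\<^sub>R \<epsilon> *\<^sub>R v"
    using orbit_bound_uniform[OF u(1)] by blast
  show ?thesis
    unfolding ru_uniformly_continuous_def
  proof (intro exI[of _ v] conjI v(1) allI impI)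
    fix \<epsilon> :: real assume e: "\<epsilon> > 0"
    obtain \<delta> where "\<delta> > 0" and d: "\<And>h. 0 < h \<Longrightarrow> h < \<delta> \<Longrightarrow> modulus (laplace_integrand T l x h - x) \<le> \<epsilon> *\<^sub>R u"
      using u(2)[OF e] unfolding eventually_at_right_field by blast
    show "\<exists>\<delta>>0. \<forall>s t. 0 \<le> s \<longrightarrow> s \<le> t \<longrightarrow> t - s \<le> \<delta> \<longrightarrow>
        modulus (laplace_integrand T l x t - laplace_integrand T l x s) \<le> \<epsilon> *\<^sub>R v"
    proof (intro exI[of _ "\<delta> / 2"] conjI allI impI)
      fix s t :: real assume st: "0 \<le> s" "s \<le> t" "t - s \<le> \<delta> / 2"
      define h where "h = t - s"
      have h: "0 \<le> h" "t = s + h" "h < \<delta>" using st \<open>\<delta> > 0\<close> by (simp_all add: h_def)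
      have "modulus (laplace_integrand T l x h - x) \<le> \<epsilon> *\<^sub>R u"
        using d[of h] h e u by (cases "h = 0") (auto simp: scaleR_nonneg_nonneg)
      then have "modulus (T s (laplace_integrand T l x h - x)) \<le> exp (w * s) *\<^sub>R \<epsilon> *\<^sub>R v"
        using st e by (intro v) auto
      from laplace_integrand_le[OF this]
      have "modulus (laplace_integrand T l (laplace_integrand T l x h - x) s)
        \<le> exp (- (Re l - w) * s) *\<^sub>R \<epsilon> *\<^sub>R v" .
      also have "laplace_integrand T l (laplace_integrand T l x h - x) s
        = laplace_integrand T l x t - laplace_integrand T l x s"
        unfolding h(2) laplace_integrand_add[OF st(1) h(1)] laplace_integrand_diff[OF st(1)]
        by (simp add: laplace_integrand_def)
      also have "exp (- (Re l - w) * s) *\<^sub>R \<epsilon> *\<^sub>R v \<le> 1 *\<^sub>R \<epsilon> *\<^sub>R v"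
        using l st e v(1) by (intro scaleR_right_mono scaleR_nonneg_nonneg) (simp_all add: mult_nonpos_nonneg)
      finally show "modulus (laplace_integrand T l x t - laplace_integrand T l x s) \<le> \<epsilon> *\<^sub>R v" by simp
    qed (use \<open>\<delta> > 0\<close> in simp)
  qed
qed

lemma laplace_primitive:
  assumes l: "w < Re l"
  obtains F where "ru_primitive F (laplace_integrand T l x)" "F 0 = 0"
    "ru_tendsto F (laplace_operator T l x) at_top"
proof -
  obtain F where F: "ru_primitive F (laplace_integrand T l x)" "F 0 = 0"
    using ru_primitive_exists[OF laplace_integrand_uniformly_continuous[OF l]] by blast
  obtain u where u: "0 \<le> u" "\<And>t. 0 \<le> t \<Longrightarrow> modulus (T t x) \<le> exp (w * t) *\<^sub>R u"
    using orbit_bound by blast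
  obtain J where J: "ru_tendsto F J at_top"
    using ru_primitive_limit[OF F(1) _ u(1) laplace_integrand_le[OF u(2)]] l by auto
  have "laplace_operator T l x = J"
    unfolding laplace_operator_def by (rule improper_ru_integral_primitive(2)[OF F J])
  with F J show ?thesis using that by blast
qed

lemma laplace_improper_ru_integrable:
  assumes l: "w < Re l"
  shows "improper_ru_integrable (laplace_integrand T l x)"
  using laplace_primitive[OF l, of x] improper_ru_integral_primitive(1) by blast

lemma laplace_operator_eqI:
  "ru_primitive F (laplace_integrand T l x) \<Longrightarrow> F 0 = 0 \<Longrightarrow> ru_tendsto F J at_top \<Longrightarrow>
    laplace_operator T l x = J"
  unfolding laplace_operator_def by (rule improper_ru_integral_primitive(2))

lemma laplace_operator_le:
  assumes l: "w < Re l" and u: "0 \<le> u" "\<And>t. 0 \<le> t \<Longrightarrow> modulus (T t x) \<le> exp (w * t) *\<^sub>R u"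
  shows "modulus (laplace_operator T l x) \<le> (1 / (Re l - w)) *\<^sub>R u"
proof -
  obtain F where F: "ru_primitive F (laplace_integrand T l x)" "F 0 = 0"
    "ru_tendsto F (laplace_operator T l x) at_top"
    using laplace_primitive[OF l] by blast
  obtain J where J: "ru_tendsto F J at_top" "modulus (J - F 0) \<le> (1 / (Re l - w)) *\<^sub>R u"
    using ru_primitive_limit[OF F(1) _ u(1) laplace_integrand_le[OF u(2)]] l by auto
  have "J = laplace_operator T l x"
    using J(1) F(3) trivial_limit_at_top_linorder by (rule ru_tendsto_unique)
  with J(2) F(2) show ?thesis by simp
qed

lemma laplace_operator_linear:
  assumes l: "w < Re l"
  shows "Vector_Spaces.linear scaleC scaleC (laplace_operator T l)"
proof (rule linearI)
  fix x y
  obtain F where F: "ru_primitive F (laplace_integrand T l x)" "F 0 = 0"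
    "ru_tendsto F (laplace_operator T l x) at_top"
    using laplace_primitive[OF l] by blast
  obtain G where G: "ru_primitive G (laplace_integrand T l y)" "G 0 = 0"
    "ru_tendsto G (laplace_operator T l y) at_top"
    using laplace_primitive[OF l] by blast
  show "laplace_operator T l (x + y) = laplace_operator T l x + laplace_operator T l y"
  proof (rule laplace_operator_eqI)
    show "ru_primitive (\<lambda>t. F t + G t) (laplace_integrand T l (x + y))"
      by (rule ru_primitive_cong[OF ru_primitive_add[OF F(1) G(1)]])
        (simp add: laplace_integrand_def T_linear_ops complexification.scale_right_distrib)
    show "F 0 + G 0 = 0" by (simp add: F G)
    show "ru_tendsto (\<lambda>t. F t + G t) (laplace_operator T l x + laplace_operator T l y) at_top"
      by (rule ru_tendsto_add[OF F(3) G(3)])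
  qed
  fix c
  show "laplace_operator T l (c *\<^sub>C x) = c *\<^sub>C laplace_operator T l x"
  proof (rule laplace_operator_eqI)
    show "ru_primitive (\<lambda>t. c *\<^sub>C F t) (laplace_integrand T l (c *\<^sub>C x))"
      by (rule ru_primitive_cong[OF ru_primitive_order_bounded[OF order_bounded_scaleC F(1)]])
        (simp add: laplace_integrand_def T_linear_ops mult.commute)
    show "c *\<^sub>C F 0 = 0" by (simp add: F)
    show "ru_tendsto (\<lambda>t. c *\<^sub>C F t) (c *\<^sub>C laplace_operator T l x) at_top"
      by (rule ru_tendsto_scaleC[OF tendsto_const F(3)])
  qed
qed

lemma laplace_operator_order_bounded:
  assumes l: "w < Re l"
  shows "order_bounded (laplace_operator T l)"
  unfolding order_bounded_def
proof (intro conjI laplace_operator_linear l allI impI)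
  fix u :: 'a assume "0 \<le> u"
  then obtain v where v: "0 \<le> v"
    "\<And>t \<epsilon> z. 0 \<le> t \<Longrightarrow> 0 \<le> \<epsilon> \<Longrightarrow> modulus z \<le> \<epsilon> *\<^sub>R u \<Longrightarrow> modulus (T t z) \<le> exp (w * t) *\<^sub>R \<epsilon> *\<^sub>R v"
    using orbit_bound_uniform by blast
  have "modulus (laplace_operator T l z) \<le> (1 / (Re l - w)) *\<^sub>R v" if "modulus z \<le> u" for z
    using v(2)[of _ 1 z] that by (intro laplace_operator_le[OF l v(1)]) simp
  then show "\<exists>v\<ge>0. \<forall>z. modulus z \<le> u \<longrightarrow> modulus (laplace_operator T l z) \<le> v"
    using v(1) l by (intro exI[of _ "(1 / (Re l - w)) *\<^sub>R v"]) (auto simp: scaleR_nonneg_nonneg)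
qed

lemma laplace_operator_commute:
  assumes l: "w < Re l" and t: "0 \<le> t"
  shows "laplace_operator T l (T t x) = T t (laplace_operator T l x)"
proof -
  obtain F where F: "ru_primitive F (laplace_integrand T l x)" "F 0 = 0"
    "ru_tendsto F (laplace_operator T l x) at_top"
    using laplace_primitive[OF l] by blast
  show ?thesis
  proof (rule laplace_operator_eqI)
    have "T t (laplace_integrand T l x s) = laplace_integrand T l (T t x) s" if "0 \<le> s" for s
    proof -
      have "T t (T s x) = T s (T t x)"
        using T_add[OF that t, of x] T_add[OF t that, of x] by (simp only: add.commute)
      then show ?thesis using t by (simp add: laplace_integrand_def T_linear_ops)
    qed
    then show "ru_primitive (\<lambda>s. T t (F s)) (laplace_integrand T l (T t x))"
      by (rule ru_primitive_cong[OF ru_primitive_order_bounded[OF T_order_bounded[OF t] F(1)]])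
    show "T t (F 0) = 0" using F(2) t by (simp add: T_linear_ops)
    show "ru_tendsto (\<lambda>s. T t (F s)) (T t (laplace_operator T l x)) at_top"
      by (rule order_bounded_ru_tendsto[OF T_order_bounded[OF t] F(3)])
  qed
qed

lemma laplace_operator_positive:
  assumes l: "w < Re l" "l \<in> \<real>"
  shows "positive_operator (laplace_operator T l)"
  unfolding positive_operator_def
proof (intro conjI laplace_operator_linear l(1) image_subsetI)
  fix x :: "'a complexification" assume x: "x \<in> positive_cone"
  obtain F where F: "ru_primitive F (laplace_integrand T l x)" "F 0 = 0"
    "ru_tendsto F (laplace_operator T l x) at_top"
    using laplace_primitive[OF l(1)] by blast
  obtain r where r: "l = complex_of_real r" using l(2) by (auto elim: Reals_cases)
  have "laplace_integrand T l x t \<in> positive_cone" if "0 \<le> t" for t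
  proof -
    have "exp (- l * complex_of_real t) = complex_of_real (exp (- r * t))"
      by (simp add: r exp_of_real flip: of_real_mult of_real_minus)
    moreover have "T t x \<in> positive_cone"
      using T_positive[OF that] x by (auto simp: positive_operator_def)
    ultimately show ?thesis
      unfolding laplace_integrand_def by (simp add: positive_cone_iff scaleR_nonneg_nonneg)
  qed
  then have "F s \<in> positive_cone" if "0 \<le> s" for s
    using has_ru_integral_positive[OF ru_primitive_has_integral[OF F(1) that] that] F(2) by simp
  then have "\<forall>\<^sub>F s in at_top. F s \<in> positive_cone"
    by (rule eventually_mono[OF eventually_ge_at_top[of 0]])
  then show "laplace_operator T l x \<in> positive_cone"
    by (rule positive_cone_closed[OF F(3) trivial_limit_at_top_linorder])
qed

text \<open>Induction on \<open>k\<close> works because the claim is made for the whole orbit, not only for \<open>t = 0\<close>: the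
  induction hypothesis bounds the orbit of \<open>T t (R l ^ k x)\<close> by \<open>exp (w s)\<close> times a fixed element.\<close>

lemma laplace_operator_power_le:
  assumes l: "w < Re l" and u: "0 \<le> u" "\<And>t. 0 \<le> t \<Longrightarrow> modulus (T t x) \<le> exp (w * t) *\<^sub>R u"
    and "0 \<le> t"
  shows "modulus (T t ((laplace_operator T l ^^ k) x)) \<le> exp (w * t) *\<^sub>R (1 / (Re l - w) ^ k) *\<^sub>R u"
  using \<open>0 \<le> t\<close>
proof (induction k arbitrary: t)
  case 0
  then show ?case using u by simp
next
  case (Suc k)
  define y where "y = (laplace_operator T l ^^ k) x"
  define v where "v = (1 / (Re l - w) ^ k) *\<^sub>R u"
  have v: "0 \<le> exp (w * t) *\<^sub>R v" using l u by (simp add: v_def scaleR_nonneg_nonneg)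
  have "modulus (T s (T t y)) \<le> exp (w * s) *\<^sub>R exp (w * t) *\<^sub>R v" if "0 \<le> s" for s
    using Suc.IH[of "s + t"] that Suc.prems T_add[of t s y]
    by (simp add: y_def v_def distrib_left exp_add)
  then have "modulus (laplace_operator T l (T t y)) \<le> (1 / (Re l - w)) *\<^sub>R exp (w * t) *\<^sub>R v"
    by (intro laplace_operator_le[OF l v])
  then show ?case
    using laplace_operator_commute[OF l Suc.prems, of y] by (simp add: y_def v_def mult.commute)
qed

section \<open>The Laplace transform as resolvent of the generator\<close>

text \<open>As functions of \<open>s\<close>, \<open>exp (- l h) T h (F s)\<close> and \<open>F (h + s) - F h\<close> are primitives of the same function
  and both vanish at \<open>0\<close>; let \<open>s\<close> tend to infinity.\<close>

lemma laplace_operator_shift: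
  assumes l: "w < Re l" and h: "0 \<le> h"
    and F: "ru_primitive F (laplace_integrand T l x)" "F 0 = 0"
  shows "exp (- l * complex_of_real h) *\<^sub>C T h (laplace_operator T l x) = laplace_operator T l x - F h"
proof -
  define e where "e = exp (- l * complex_of_real h)"
  obtain G where G: "ru_primitive G (laplace_integrand T l x)" "G 0 = 0"
    "ru_tendsto G (laplace_operator T l x) at_top"
    using laplace_primitive[OF l] by blast
  have GF: "G s = F s" if "0 \<le> s" for s using ru_primitive_unique[OF F(1) G(1) that] F G by simp
  have "ru_primitive (\<lambda>t. e *\<^sub>C T h (G t)) (\<lambda>t. e *\<^sub>C T h (laplace_integrand T l x t))"
    by (intro ru_primitive_order_bounded[OF order_bounded_scaleC]
        ru_primitive_order_bounded[OF T_order_bounded[OF h]] G)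
  then have "ru_primitive (\<lambda>t. e *\<^sub>C T h (G t)) (\<lambda>t. laplace_integrand T l x (h + t))"
    by (rule ru_primitive_cong) (simp add: laplace_integrand_add[OF h] e_def)
  from ru_primitive_unique[OF this ru_primitive_shift[OF G(1) h]]
  have "e *\<^sub>C T h (G s) = G (h + s) - F h" if "0 \<le> s" for s
    using that h by (simp add: G GF T_linear_ops)
  then have eq: "\<forall>\<^sub>F s in at_top. e *\<^sub>C T h (G s) = G (h + s) - F h"
    by (rule eventually_mono[OF eventually_ge_at_top[of 0]])
  have "filterlim (\<lambda>s. h + s) at_top at_top"
    by (intro filterlim_tendsto_add_at_top[OF tendsto_const] filterlim_ident)
  then have "ru_tendsto (\<lambda>s. G (h + s) - F h) (laplace_operator T l x - F h) at_top"
    by (intro ru_tendsto_diff ru_tendsto_const ru_tendsto_compose[OF G(3)])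
  from ru_tendsto_cong[OF this eq]
  have "ru_tendsto (\<lambda>s. e *\<^sub>C T h (G s)) (laplace_operator T l x - F h) at_top" .
  moreover have "ru_tendsto (\<lambda>s. e *\<^sub>C T h (G s)) (e *\<^sub>C T h (laplace_operator T l x)) at_top"
    by (intro ru_tendsto_scaleC[OF tendsto_const] order_bounded_ru_tendsto[OF T_order_bounded[OF h]] G)
  ultimately show ?thesis
    unfolding e_def using ru_tendsto_unique trivial_limit_at_top_linorder by metis
qed

text \<open>By the shift formula the difference quotient of \<open>y = R l x\<close> is
  \<open>((exp (l h) - 1) / h) y - exp (l h) F h / h\<close>, and \<open>F h / h\<close> tends to the integrand at \<open>0\<close>, which is \<open>x\<close>.\<close>

lemma laplace_operator_generator:
  assumes l: "w < Re l"
  shows "ru_tendsto (difference_quotient T (laplace_operator T l x))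
    (l *\<^sub>C laplace_operator T l x - x) (at_right 0)"
proof -
  define y where "y = laplace_operator T l x"
  obtain F where F: "ru_primitive F (laplace_integrand T l x)" "F 0 = 0"
    using laplace_primitive[OF l] by blast
  have Th: "T h y = exp (l * complex_of_real h) *\<^sub>C (y - F h)" if "0 \<le> h" for h
    unfolding y_def laplace_operator_shift[OF l that F, symmetric]
    by (simp flip: exp_add)
  obtain u where u: "0 \<le> u" and p: "\<And>\<epsilon>. \<epsilon> > 0 \<Longrightarrow> \<exists>\<delta>>0. \<forall>a t b. 0 \<le> a \<longrightarrow> a \<le> t \<longrightarrow> t \<le> b \<longrightarrow> b - a \<le> \<delta> \<longrightarrow>
     modulus (F b - F a - complex_of_real (b - a) *\<^sub>C laplace_integrand T l x t) \<le> (\<epsilon> * (b - a)) *\<^sub>R u"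
    using F(1) by (rule ru_primitiveE) blast
  have "ru_tendsto (\<lambda>h. complex_of_real (1 / h) *\<^sub>C F h) x (at_right 0)"
  proof (rule ru_tendstoI[OF u])
    fix \<epsilon> :: real assume "\<epsilon> > 0"
    then obtain \<delta> where "\<delta> > 0" and d: "\<And>a t b. 0 \<le> a \<Longrightarrow> a \<le> t \<Longrightarrow> t \<le> b \<Longrightarrow> b - a \<le> \<delta> \<Longrightarrow>
     modulus (F b - F a - complex_of_real (b - a) *\<^sub>C laplace_integrand T l x t) \<le> (\<epsilon> * (b - a)) *\<^sub>R u"
      using p by blast
    have "modulus (complex_of_real (1 / h) *\<^sub>C F h - x) \<le> \<epsilon> *\<^sub>R u" if h: "0 < h" "h < \<delta>" for h
    proof -
      have "modulus (complex_of_real (1 / h) *\<^sub>C (F h - complex_of_real h *\<^sub>C x)) \<le> (1 / h) *\<^sub>R (\<epsilon> * h) *\<^sub>R u"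
        using d[of 0 0 h] h F(2) by (intro modulus_scaleC_mono) (auto simp: norm_divide)
      with h show ?thesis by (simp add: complexification.scale_right_diff_distrib)
    qed
    with \<open>\<delta> > 0\<close> show "\<forall>\<^sub>F h in at_right 0. modulus (complex_of_real (1 / h) *\<^sub>C F h - x) \<le> \<epsilon> *\<^sub>R u"
      unfolding eventually_at_right_field by blast
  qed
  moreover have "((\<lambda>h. exp (l * complex_of_real h)) \<longlongrightarrow> exp (l * complex_of_real 0)) (at_right 0)"
    by (intro tendsto_intros)
  ultimately have "ru_tendsto (\<lambda>h. exp (l * complex_of_real h) *\<^sub>C complex_of_real (1 / h) *\<^sub>C F h)
      (exp (l * complex_of_real 0) *\<^sub>C x) (at_right 0)"
    by (rule ru_tendsto_scaleC[rotated])
  then have "ru_tendsto (\<lambda>h. exp (l * complex_of_real h) *\<^sub>C complex_of_real (1 / h) *\<^sub>C F h) x (at_right 0)"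
    by simp
  then have lim: "ru_tendsto (\<lambda>h. ((exp (l * complex_of_real h) - 1) / complex_of_real h) *\<^sub>C y
      - exp (l * complex_of_real h) *\<^sub>C complex_of_real (1 / h) *\<^sub>C F h) (l *\<^sub>C y - x) (at_right 0)"
    by (intro ru_tendsto_diff ru_tendsto_scaleC exp_difference_quotient ru_tendsto_const)
  show ?thesis
    unfolding y_def[symmetric]
  proof (rule ru_tendsto_cong[OF lim])
    show "\<forall>\<^sub>F h in at_right 0. difference_quotient T y h =
      ((exp (l * complex_of_real h) - 1) / complex_of_real h) *\<^sub>C y
      - exp (l * complex_of_real h) *\<^sub>C complex_of_real (1 / h) *\<^sub>C F h"
      using eventually_at_right_less[of 0]
    proof eventually_elim
      case (elim h)
      have "(e - 1) / c = (1 / c) * e - 1 / c" for e c :: complex by (simp add: diff_divide_distrib)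
      then show ?case
        using elim by (simp add: Th complexification.scale_right_diff_distrib
            complexification.scale_left_diff_distrib mult.commute)
    qed
  qed
qed

lemma laplace_operator_right_inverse:
  assumes l: "w < Re l"
  shows "laplace_operator T l x \<in> generator_domain T"
    "l *\<^sub>C laplace_operator T l x - generator T (laplace_operator T l x) = x"
  using laplace_operator_generator[OF l, of x] generator_eqI[of T, OF laplace_operator_generator[OF l, of x]]
  by (auto simp: generator_domain_def)

text \<open>The operator \<open>R l\<close> sends the difference quotients of \<open>x\<close> to those of \<open>R l x\<close>, and it preserves their
  limit. Hence \<open>R l (A x) = A (R l x) = l R l x - x\<close>.\<close>

lemma laplace_operator_left_inverse:
  assumes l: "w < Re l" and x: "x \<in> generator_domain T"
  shows "laplace_operator T l (l *\<^sub>C x - generator T x) = x"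
proof -
  note lin = linear_ops[OF laplace_operator_linear[OF l]]
  obtain y where y: "ru_tendsto (difference_quotient T x) y (at_right 0)"
    using x by (auto simp: generator_domain_def)
  have "\<forall>\<^sub>F h in at_right 0. laplace_operator T l (difference_quotient T x h)
      = difference_quotient T (laplace_operator T l x) h"
    using eventually_at_right_less[of 0]
    by eventually_elim (simp add: lin laplace_operator_commute[OF l])
  from ru_tendsto_cong[OF laplace_operator_generator[OF l] this]
  have "laplace_operator T l y = l *\<^sub>C laplace_operator T l x - x"
    by (rule ru_tendsto_unique[OF order_bounded_ru_tendsto[OF laplace_operator_order_bounded[OF l] y]]) simp
  then show ?thesis by (simp add: lin generator_eqI[of T, OF y])
qed

lemma resolvent_exists:
  assumes "w < Re l"
  shows "resolvent_exists (generator_domain T) (generator T) l"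
  unfolding resolvent_exists_def
  using laplace_operator_left_inverse[OF assms] laplace_operator_right_inverse[OF assms]
  by (intro bij_betwI[where g = "laplace_operator T l"]) auto

lemma laplace_operator_eq_resolvent:
  assumes "w < Re l"
  shows "laplace_operator T l = resolvent (generator_domain T) (generator T) l"
proof
  fix x
  have "inj_on (\<lambda>x. l *\<^sub>C x - generator T x) (generator_domain T)"
    using resolvent_exists[OF assms] by (simp add: resolvent_exists_def bij_betw_def)
  from inv_into_f_eq[OF this laplace_operator_right_inverse[OF assms]]
  show "laplace_operator T l x = resolvent (generator_domain T) (generator T) l x"
    by (simp add: resolvent_def)
qed

end

theorem proposition5p1:
  fixes T :: "real \<Rightarrow> 'a::ru_complete_vector_lattice complexification \<Rightarrow> 'a complexification"
    and w :: real
  assumes "ru_continuous_semigroup T"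
    and "positive_semigroup T"
    and "exponentially_order_bounded T w"
  shows
    "(\<forall>l. w < Re l \<longrightarrow>
        (\<forall>x. improper_ru_integrable (laplace_integrand T l x)) \<and>
        Vector_Spaces.linear scaleC scaleC (laplace_operator T l) \<and>
        (l \<in> \<real> \<longrightarrow> positive_operator (laplace_operator T l))) \<and>
     (\<forall>x. \<exists>u\<ge>0. \<forall>k::nat. \<forall>l. w < Re l \<longrightarrow>
        modulus ((laplace_operator T l ^^ k) x) \<le> (1 / (Re l - w) ^ k) *\<^sub>R u) \<and>
     {l. w < Re l \<and> l \<in> \<real>} \<subseteq> positive_resolvent_set (generator_domain T) (generator T) \<and>
     (\<forall>l. w < Re l \<longrightarrow>
        resolvent_exists (generator_domain T) (generator T) l \<and>
        laplace_operator T l = resolvent (generator_domain T) (generator T) l)"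
proof -
  interpret exp_bounded_positive_semigroup T w
    using assms by unfold_locales
  have powers: "\<exists>u\<ge>0. \<forall>k::nat. \<forall>l. w < Re l \<longrightarrow>
      modulus ((laplace_operator T l ^^ k) x) \<le> (1 / (Re l - w) ^ k) *\<^sub>R u" for x
  proof -
    obtain u where u: "0 \<le> u" "\<And>t. 0 \<le> t \<Longrightarrow> modulus (T t x) \<le> exp (w * t) *\<^sub>R u"
      using orbit_bound by blast
    then show ?thesis using laplace_operator_power_le[OF _ u, where t = 0] by auto
  qed
  have "{l. w < Re l \<and> l \<in> \<real>} \<subseteq> positive_resolvent_set (generator_domain T) (generator T)"
    using resolvent_exists laplace_operator_positive laplace_operator_eq_resolvent
    by (auto simp: positive_resolvent_set_def)
  with powers show ?thesis
    using laplace_improper_ru_integrable laplace_operator_linear laplace_operator_positive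
      resolvent_exists laplace_operator_eq_resolvent by blast
qed

end
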